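(* Let $\mathfrak C=(n,\Lambda,L,P)$ be a Lagrangian stabilizer code with $R=\mathbb Z_n[\Lambda]$, $D=\mathrm{rk}(\Lambda)$, all of whose charge modules $Q^i(\mathfrak C)=\mathrm{Ext}^{i+1}_R(\overline{P/L},R)$ ($i\ge 0$) are zero or have Krull dimension $0$. Let $\Gamma\subset\Lambda$ be a finite index subgroup, free with basis $\gamma_1,\dots,\gamma_D$, such that $x^\gamma-1$ annihilates all $Q^i(\mathfrak C)$ for all $\gamma\in\Gamma$, and let $t_j=1-x^{\gamma_j}$, $\mathbf t=(t_1,\dots,t_D)$. Let $\varphi\in\check{\mathrm C}^p(\mathbf t,P/L)$ be a Čech cocycle, and let $\widetilde\varphi\in\check{\mathrm C}^p(\mathbf t,P)$ be a lift of $\varphi$. For $1\le i_1<\dots<i_p\le D$ put $$\widetilde\varphi^{\mathrm{Res}}_{i_1\dots i_p}=\sum_{s_{i_1},\dots,s_{i_p}\in\{\pm\}}s_{i_1}\cdots s_{i_p}\,\widetilde\varphi^{\,s}_{i_1\dots i_p}\in\widehat P .$$ Then: (a) $\omega(l,\widetilde\varphi^{\mathrm{Res}}_{i_1\dots i_p})=0$ for every $l\in L$ and all $i_1<\dots<i_p$, i.e. $\widetilde\varphi^{\mathrm{Res}}_{i_1\dots i_p}$ preserves the state defined by the stabilizer condition. (b) If $\widetilde\varphi'$ is another lift of $\varphi$, then each $\widetilde\varphi'^{\,\mathrm{Res}}_{i_1\dots i_p}-\widetilde\varphi^{\mathrm{Res}}_{i_1\dots i_p}$ is a (possibly infinite)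 sum of elements of $L$, i.e. it lies in the image of $L\otimes_R R^{\#}\to P\otimes_R R^{\#}=\widehat P$. (c) If $\varphi=\delta\psi$ with $\psi\in\check{\mathrm C}^{p-1}(\mathbf t,P/L)$, $\widetilde\psi\in\check{\mathrm C}^{p-1}(\mathbf t,P)$ is a lift of $\psi$ and $\widetilde\varphi=\delta\widetilde\psi$, then $\widetilde\varphi^{\mathrm{Res}}_{i_1\dots i_p}=0$ for all $i_1<\dots<i_p$. Thus the family of the operators $\widetilde\varphi^{\mathrm{Res}}_{i_1\dots i_p}$, one for each coordinate $p$-plane, defines a $(D-p)$-form symmetry of $\mathfrak C$, which (regarding $p$-dimensional operators, $p\ge1$, that are infinite sums of elements of $L$ as trivial) depends only on the cohomology class of $\varphi$.
   Context: Let $n$ be a positive integer, $\mathbb Z_n=\mathbb Z/n\mathbb Z$, $\Lambda$ a finitely generated abelian group of free rank $D$, $R=\mathbb Z_n[\Lambda]$ its group ring, $x^\lambda\in R$ the element corresponding to $\lambda\in\Lambda$. The antipode of $R$ is $\overline{\sum_\lambda r_\lambda x^\lambda}=\sum_\lambda r_\lambda x^{-\lambda}$; for an $R$-module $M$, $\overline M$ is the same abelian group with $R$-action twisted by the antipode. A stabilizer code $(n,\Lambda,L,P)$ consists of: $P=P_0[\Lambda]=P_0\otimes_{\mathbb Z_n}R$, where $P_0$ is a finitely generated $\mathbb Z_n$-module with an alternating ($\omega_0(a,a)=0$), nondegenerate ($\omega_0(\cdot,a)=0\Rightarrow a=0$) bilinear form $\omega_0:P_0\times P_0\to\mathbb Z_n$,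 equipped with the form $\omega:P\times P\to R$, $\omega(a x^\lambda,b x^\mu)=\omega_0(a,b)x^{\mu-\lambda}$ (extended $\mathbb Z_n$-bilinearly); and an $R$-submodule $L\subset P$ with $\omega|_{L\times L}=0$. It is Lagrangian if $L=\{p\in P:\omega(l,p)=0\ \forall l\in L\}$. Elements of $P$ represent local Pauli operators modulo phases, and the state defined by the stabilizer condition is the one fixed by the operators in $L$. A $(D-p)$-form symmetry here means a family of operators extended in $p$ directions, one for each coordinate $p$-plane, preserving this state. Čech complex: $\check{\mathrm C}^0(\mathbf t,M)=M$, $\check{\mathrm C}^p(\mathbf t,M)=\bigoplus_{i_1<\dots<i_p}M_{t_{i_1}\cdots t_{i_p}}$, $(\delta\varphi)_{i_0\dots i_p}=\sum_{j=0}^p(-1)^j\varphi_{i_0\dots i_{j-1}i_{j+1}\dots i_p}$. $R^{\#}=\mathrm{Hom}_{\mathbb Z_n}(R,\mathbb Z_n)$ is identified with the $R$-module $\mathbb Z_n[[\Lambda]]$ of formal sums $\sum_{\lambda\in\Lambda}r_\lambda x^\lambda$ (arbitrary coefficients), and $\widehat P=P\otimes_R R^{\#}\cong P_0[[\Lambda]]$ (formal sums with coefficients in $P_0$). The form $\omega$ extends to a pairing $P\times\widehat P\to R^{\#}$ by the same formula. Products of formal sums are taken when every coefficient of the product is a finite sum. With $x_i=x^{\gamma_i}$ put $(1/t_i)_+=\sum_{j\ge0}x_i^j$ and $(1/t_i)_-=-\sum_{j\ge1}x_i^{-j}$ in $R^{\#}$. For $s=(s_1,\dots,s_D)\in\{\pm\}^D$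 and $\pi=\frac{q}{t_1^{k_1}\cdots t_D^{k_D}}\in P_{t_1\cdots t_D}$ ($q\in P$), $\pi^s=q\prod_{i=1}^D(1/t_i)_{s_i}^{k_i}\in\widehat P$; this defines an embedding of $P_{t_1\cdots t_D}$, hence of every $P_{t_{i_1}\cdots t_{i_p}}$, into $\widehat P$, and for $\pi\in P_{t_{i_1}\cdots t_{i_p}}$ the element $\pi^s$ depends only on $s_{i_1},\dots,s_{i_p}$. Signs $s_i$ are read as $\pm1$ in products.
   Formalization: Part (a) and the claim of defining a (D-p)-form symmetry are stated only for p < D; at p = D they are false, since every top-degree cochain is a cocycle (e.g. n=2, Λ=Z, L=RZ, φ=[X]/t gives ω(Z,Res)=Σx^j≠0). *)

theory Defs
  imports
    "HOL-Library.Poly_Mapping"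
    "HOL-Library.Extended_Real"
    "Berlekamp_Zassenhaus.Finite_Field"
    "HOL-Algebra.AbelCoset"
    "HOL-Algebra.Ideal"
    "HOL-Algebra.Module"
begin

section \<open>Abelian groups as modules over the integers\<close>

definition zscale :: "int \<Rightarrow> 'a \<Rightarrow> 'a::ab_group_add" where
  "zscale k a = (\<Sum>i<nat k. a) - (\<Sum>i<nat (- k). a)"

lemma zscale_add_left: "zscale (k + l) a = zscale k a + zscale l a"
proof -
  define f :: "nat \<Rightarrow> 'a" where "f m = (\<Sum>i<m. a)" for m
  have f_add: "f (m + m') = f m + f m'" for m m'
    by (induction m') (auto simp: f_def algebra_simps)
  have f_diff: "f m - f m' = f q - f q'" if "m + q' = q + m'" for m m' q q'
  proof -
    have "f m + f q' = f q + f m'" by (metis f_add that)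
    then show ?thesis by (simp add: algebra_simps)
  qed
  have "f (nat (k + l)) - f (nat (- (k + l)))
      = f (nat k + nat l) - f (nat (- k) + nat (- l))"
    by (rule f_diff) linarith
  then show ?thesis
    by (simp add: zscale_def f_add flip: f_def)
qed

lemma zscale_add_right: "zscale k (a + b) = zscale k a + zscale k b"
  by (simp add: zscale_def sum.distrib)

lemma zscale_nat: "zscale (int m) a = (\<Sum>i<m. a)"
  by (simp add: zscale_def)

lemma zscale_uminus: "zscale (- k) a = - zscale k a"
  by (simp add: zscale_def)

lemma zscale_zscale: "zscale k (zscale l a) = zscale (k * l) a"
proof -
  have one: "zscale 1 b = b" for b :: 'a by (simp add: zscale_def)
  have nat_case: "zscale (int m) (zscale l a) = zscale (int m * l) a" for m
    by (induction m) (simp_all add: zscale_add_left distrib_right one, simp_all add: zscale_def)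
  show ?thesis
  proof (cases k rule: int_cases2)
    case (nonneg m) then show ?thesis by (simp add: nat_case)
  next
    case (nonpos m) then show ?thesis by (simp add: nat_case zscale_uminus)
  qed
qed

interpretation zmod: Modules.module "zscale :: int \<Rightarrow> 'a::ab_group_add \<Rightarrow> 'a"
  by unfold_locales
    (simp_all add: zscale_add_left zscale_add_right zscale_zscale, simp add: zscale_def)

definition free_rank :: "'a::ab_group_add itself \<Rightarrow> nat" where
  "free_rank _ = Sup {card S | S :: 'a set. finite S \<and> \<not> zmod.dependent S}"

definition finite_index :: "'a::ab_group_add set \<Rightarrow> bool" where
  "finite_index H \<longleftrightarrow> finite (range (\<lambda>a. (\<lambda>h. a + h) ` H))"


section \<open>Module constructions\<close>

text \<open>
  Only \<open>carrier\<close>, \<open>zero\<close>, \<open>add\<close> and \<open>smult\<close> of a module record are meaningful.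
\<close>

definition mk_module :: "'b set \<Rightarrow> 'b \<Rightarrow> ('b \<Rightarrow> 'b \<Rightarrow> 'b) \<Rightarrow> ('r \<Rightarrow> 'b \<Rightarrow> 'b) \<Rightarrow> ('r, 'b) module"
  where "mk_module C z a s =
    \<lparr>carrier = C, monoid.mult = undefined, one = undefined, zero = z, add = a, Module.module.smult = s\<rparr>"

definition regular_module :: "('r, 'x) ring_scheme \<Rightarrow> ('r, 'r) module" where
  "regular_module R = mk_module (carrier R) \<zero>\<^bsub>R\<^esub> (add R) (monoid.mult R)"

definition quot_module :: "('r, 'b) module \<Rightarrow> 'b set \<Rightarrow> ('r, 'b set) module" where
  "quot_module M H =
    mk_module (a_rcosets\<^bsub>M\<^esub> H) H (\<lambda>X Y. X <+>\<^bsub>M\<^esub> Y)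
      (\<lambda>r X. \<Union>x\<in>X. H +>\<^bsub>M\<^esub> (r \<odot>\<^bsub>M\<^esub> x))"

definition twist_module :: "('r \<Rightarrow> 'r) \<Rightarrow> ('r, 'b) module \<Rightarrow> ('r, 'b) module" where
  "twist_module \<sigma> M = M\<lparr>Module.module.smult := (\<lambda>r x. \<sigma> r \<odot>\<^bsub>M\<^esub> x)\<rparr>"

definition lin_maps ::
    "('r, 'x) ring_scheme \<Rightarrow> ('r, 'b) module \<Rightarrow> ('r, 'c) module \<Rightarrow> ('b \<Rightarrow> 'c) set" where
  "lin_maps R M N = {f \<in> carrier M \<rightarrow>\<^sub>E carrier N.
     (\<forall>x\<in>carrier M. \<forall>y\<in>carrier M. f (x \<oplus>\<^bsub>M\<^esub> y) = f x \<oplus>\<^bsub>N\<^esub> f y) \<and>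
     (\<forall>r\<in>carrier R. \<forall>x\<in>carrier M. f (r \<odot>\<^bsub>M\<^esub> x) = r \<odot>\<^bsub>N\<^esub> f x)}"

definition hom_module ::
    "('r, 'x) ring_scheme \<Rightarrow> ('r, 'b) module \<Rightarrow> ('r, 'c) module \<Rightarrow> ('r, 'b \<Rightarrow> 'c) module" where
  "hom_module R M N =
    mk_module (lin_maps R M N) (\<lambda>x\<in>carrier M. \<zero>\<^bsub>N\<^esub>)
      (\<lambda>f g. \<lambda>x\<in>carrier M. f x \<oplus>\<^bsub>N\<^esub> g x) (\<lambda>r f. \<lambda>x\<in>carrier M. r \<odot>\<^bsub>N\<^esub> f x)"

definition annihilator :: "('r, 'x) ring_scheme \<Rightarrow> ('r, 'b) module \<Rightarrow> 'r set" where
  "annihilator R M = {r \<in> carrier R. \<forall>x\<in>carrier M. r \<odot>\<^bsub>M\<^esub> x = \<zero>\<^bsub>M\<^esub>}"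

text \<open>
  The Krull dimension of a finitely generated module \<open>M\<close> is that of \<open>R / Ann M\<close>;
  it is \<open>- \<infinity>\<close> for the zero module.
\<close>

definition krull_dim :: "('r, 'x) ring_scheme \<Rightarrow> ('r, 'b) module \<Rightarrow> ereal" where
  "krull_dim R M = Sup {ereal (real k) | k. \<exists>\<pp> :: nat \<Rightarrow> 'r set.
     (\<forall>i\<le>k. primeideal (\<pp> i) R \<and> annihilator R M \<subseteq> \<pp> i) \<and> (\<forall>i<k. \<pp> i \<subset> \<pp> (Suc i))}"


section \<open>Ext modules\<close>

text \<open>
  \<open>Ext\<close> is computed from the canonical free resolution
  \<open>\<dots> \<rightarrow> R\<^bsup>(B\<^sub>1)\<^esup> \<rightarrow> R\<^bsup>(B\<^sub>0)\<^esup> \<rightarrow> M\<close>: the basis \<open>B\<^sub>0\<close> consists of all elements of \<open>M\<close> and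
  \<open>B\<^bsub>i+1\<^esub>\<close> of all formal \<open>R\<close>-linear combinations of elements of \<open>B\<^sub>i\<close> whose value is killed by
  the map out of \<open>R\<^bsup>(B\<^sub>i)\<^esup>\<close>. The datatype below contains all the bases.
\<close>

datatype ('r, 'b) syz = Gen 'b | Syz "('r \<times> ('r, 'b) syz) list"

definition free_module :: "('r, 'x) ring_scheme \<Rightarrow> 'i set \<Rightarrow> ('r, 'i \<Rightarrow> 'r) module" where
  "free_module R B =
    mk_module {f. (\<forall>b. f b \<in> carrier R) \<and> (\<forall>b. b \<notin> B \<longrightarrow> f b = \<zero>\<^bsub>R\<^esub>) \<and> finite {b. f b \<noteq> \<zero>\<^bsub>R\<^esub>}}
      (\<lambda>b. \<zero>\<^bsub>R\<^esub>) (\<lambda>f g b. f b \<oplus>\<^bsub>R\<^esub> g b) (\<lambda>r f b. r \<otimes>\<^bsub>R\<^esub> f b)"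

definition lin_ext ::
    "('r, 'x) ring_scheme \<Rightarrow> ('r, 'c) module \<Rightarrow> ('i \<Rightarrow> 'c) \<Rightarrow> ('i \<Rightarrow> 'r) \<Rightarrow> 'c" where
  "lin_ext R M v f = (\<Oplus>\<^bsub>M\<^esub>b\<in>{b. f b \<noteq> \<zero>\<^bsub>R\<^esub>}. f b \<odot>\<^bsub>M\<^esub> v b)"

definition comb :: "('r, 'x) ring_scheme \<Rightarrow> ('r \<times> 'i) list \<Rightarrow> 'i \<Rightarrow> 'r" where
  "comb R xs = foldr (\<lambda>(r, b) f. f(b := r \<oplus>\<^bsub>R\<^esub> f b)) xs (\<lambda>b. \<zero>\<^bsub>R\<^esub>)"

fun res_aug :: "('r, 'b) syz \<Rightarrow> 'b" where
  "res_aug (Gen m) = m"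
| "res_aug (Syz xs) = undefined"

fun res_bd :: "('r, 'x) ring_scheme \<Rightarrow> ('r, 'b) syz \<Rightarrow> ('r, 'b) syz \<Rightarrow> 'r" where
  "res_bd R (Gen m) = undefined"
| "res_bd R (Syz xs) = comb R xs"

fun res_basis :: "('r, 'x) ring_scheme \<Rightarrow> ('r, 'b) module \<Rightarrow> nat \<Rightarrow> ('r, 'b) syz set" where
  "res_basis R M 0 = Gen ` carrier M"
| "res_basis R M (Suc 0) =
    {Syz xs | xs. set xs \<subseteq> carrier R \<times> res_basis R M 0 \<and>
       lin_ext R M res_aug (comb R xs) = \<zero>\<^bsub>M\<^esub>}"
| "res_basis R M (Suc (Suc i)) =
    {Syz xs | xs. set xs \<subseteq> carrier R \<times> res_basis R M (Suc i) \<and>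
       lin_ext R (free_module R (res_basis R M i)) (res_bd R) (comb R xs) = (\<lambda>b. \<zero>\<^bsub>R\<^esub>)}"

definition res_module ::
    "('r, 'x) ring_scheme \<Rightarrow> ('r, 'b) module \<Rightarrow> nat \<Rightarrow> ('r, ('r, 'b) syz \<Rightarrow> 'r) module" where
  "res_module R M i = free_module R (res_basis R M i)"

text \<open>The differential from degree \<open>i + 1\<close> to degree \<open>i\<close> of the resolution.\<close>

definition res_diff ::
    "('r, 'x) ring_scheme \<Rightarrow> ('r, 'b) module \<Rightarrow> nat \<Rightarrow> (('r, 'b) syz \<Rightarrow> 'r) \<Rightarrow> (('r, 'b) syz \<Rightarrow> 'r)"
  where "res_diff R M i = lin_ext R (res_module R M i) (res_bd R)"

definition ext_cocycles ::
    "('r, 'x) ring_scheme \<Rightarrow> nat \<Rightarrow> ('r, 'b) module \<Rightarrow> ('r, 'c) module \<Rightarrow>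
      ((('r, 'b) syz \<Rightarrow> 'r) \<Rightarrow> 'c) set" where
  "ext_cocycles R i M N = {f \<in> lin_maps R (res_module R M i) N.
     \<forall>x\<in>carrier (res_module R M (Suc i)). f (res_diff R M i x) = \<zero>\<^bsub>N\<^esub>}"

fun ext_coboundaries ::
    "('r, 'x) ring_scheme \<Rightarrow> nat \<Rightarrow> ('r, 'b) module \<Rightarrow> ('r, 'c) module \<Rightarrow>
      ((('r, 'b) syz \<Rightarrow> 'r) \<Rightarrow> 'c) set" where
  "ext_coboundaries R 0 M N = {\<lambda>x\<in>carrier (res_module R M 0). \<zero>\<^bsub>N\<^esub>}"
| "ext_coboundaries R (Suc i) M N =
    (\<lambda>g. \<lambda>x\<in>carrier (res_module R M (Suc i)). g (res_diff R M i x)) ` lin_maps R (res_module R M i) N"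

definition ext_module ::
    "('r, 'x) ring_scheme \<Rightarrow> nat \<Rightarrow> ('r, 'b) module \<Rightarrow> ('r, 'c) module \<Rightarrow>
      ('r, ((('r, 'b) syz \<Rightarrow> 'r) \<Rightarrow> 'c) set) module" where
  "ext_module R i M N =
    quot_module ((hom_module R (res_module R M i) N)\<lparr>carrier := ext_cocycles R i M N\<rparr>)
      (ext_coboundaries R i M N)"


section \<open>Localizations and the Cech complex\<close>

text \<open>
  For \<open>I = {i\<^sub>1, \<dots>, i\<^sub>p}\<close> the localization of \<open>M\<close> at \<open>t\<^bsub>i\<^sub>1\<^esub> \<cdots> t\<^bsub>i\<^sub>p\<^esub>\<close> consists of fractions \<open>m / t\<^sup>k\<close>
  with monomial denominators \<open>t\<^sup>k = (\<Prod>i\<in>I. t\<^sub>i\<^bsup>k\<^sub>i\<^esup>)\<close>.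
\<close>

definition exponents :: "nat set \<Rightarrow> (nat \<Rightarrow> nat) set" where
  "exponents I = {k. \<forall>i. i \<notin> I \<longrightarrow> k i = 0}"

definition tpow :: "('r, 'x) ring_scheme \<Rightarrow> (nat \<Rightarrow> 'r) \<Rightarrow> nat set \<Rightarrow> (nat \<Rightarrow> nat) \<Rightarrow> 'r" where
  "tpow R t I k = (\<Otimes>\<^bsub>R\<^esub>i\<in>I. t i [^]\<^bsub>R\<^esub> k i)"

definition loc_rel ::
    "('r, 'x) ring_scheme \<Rightarrow> ('r, 'b) module \<Rightarrow> (nat \<Rightarrow> 'r) \<Rightarrow> nat set \<Rightarrow>
      (('b \<times> (nat \<Rightarrow> nat)) \<times> ('b \<times> (nat \<Rightarrow> nat))) set" where
  "loc_rel R M t I = {((m, k), (m', k')).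
     m \<in> carrier M \<and> m' \<in> carrier M \<and> k \<in> exponents I \<and> k' \<in> exponents I \<and>
     (\<exists>j\<in>exponents I. tpow R t I j \<odot>\<^bsub>M\<^esub>
        (tpow R t I k' \<odot>\<^bsub>M\<^esub> m \<ominus>\<^bsub>M\<^esub> tpow R t I k \<odot>\<^bsub>M\<^esub> m') = \<zero>\<^bsub>M\<^esub>)}"

definition loc_frac ::
    "('r, 'x) ring_scheme \<Rightarrow> ('r, 'b) module \<Rightarrow> (nat \<Rightarrow> 'r) \<Rightarrow> nat set \<Rightarrow> 'b \<Rightarrow> (nat \<Rightarrow> nat) \<Rightarrow>
      ('b \<times> (nat \<Rightarrow> nat)) set" where
  "loc_frac R M t I m k = loc_rel R M t I `` {(m, k)}"

definition loc_module ::
    "('r, 'x) ring_scheme \<Rightarrow> ('r, 'b) module \<Rightarrow> (nat \<Rightarrow> 'r) \<Rightarrow> nat set \<Rightarrow>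
      ('r, ('b \<times> (nat \<Rightarrow> nat)) set) module" where
  "loc_module R M t I =
    mk_module ((carrier M \<times> exponents I) // loc_rel R M t I)
      (loc_frac R M t I (\<zero>\<^bsub>M\<^esub>) (\<lambda>i. 0))
      (\<lambda>X Y. \<Union>(m, k)\<in>X. \<Union>(m', k')\<in>Y.
         loc_frac R M t I (tpow R t I k' \<odot>\<^bsub>M\<^esub> m \<oplus>\<^bsub>M\<^esub> tpow R t I k \<odot>\<^bsub>M\<^esub> m') (\<lambda>i. k i + k' i))
      (\<lambda>r X. \<Union>(m, k)\<in>X. loc_frac R M t I (r \<odot>\<^bsub>M\<^esub> m) k)"

text \<open>
  \<open>loc_map R N t I f\<close> sends the fraction \<open>m / t\<^sup>k\<close> to \<open>f m / t\<^sup>k\<close> in the localization of \<open>N\<close> with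
  index set \<open>I\<close>; the source may be a localization with a smaller index set.
\<close>

definition loc_map ::
    "('r, 'x) ring_scheme \<Rightarrow> ('r, 'c) module \<Rightarrow> (nat \<Rightarrow> 'r) \<Rightarrow> nat set \<Rightarrow> ('b \<Rightarrow> 'c) \<Rightarrow>
      ('b \<times> (nat \<Rightarrow> nat)) set \<Rightarrow> ('c \<times> (nat \<Rightarrow> nat)) set" where
  "loc_map R N t I f X = (\<Union>(m, k)\<in>X. loc_frac R N t I (f m) k)"

text \<open>
  A strictly increasing tuple of indices is encoded by the set of its entries; indices run
  from \<open>0\<close> to \<open>D - 1\<close>.
\<close>

definition cech_index :: "nat \<Rightarrow> nat \<Rightarrow> nat set set" where
  "cech_index D p = {I. I \<subseteq> {..<D} \<and> card I = p}"

definition cech ::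
    "('r, 'x) ring_scheme \<Rightarrow> ('r, 'b) module \<Rightarrow> (nat \<Rightarrow> 'r) \<Rightarrow> nat \<Rightarrow> nat \<Rightarrow>
      (nat set \<Rightarrow> ('b \<times> (nat \<Rightarrow> nat)) set) set" where
  "cech R M t D p = (\<Pi>\<^sub>E I\<in>cech_index D p. carrier (loc_module R M t I))"

text \<open>The entry \<open>i\<close> of the increasing tuple \<open>I\<close> is in position \<open>card {j \<in> I. j < i}\<close>.\<close>

definition cech_diff ::
    "('r, 'x) ring_scheme \<Rightarrow> ('r, 'b) module \<Rightarrow> (nat \<Rightarrow> 'r) \<Rightarrow> nat \<Rightarrow> nat \<Rightarrow>
      (nat set \<Rightarrow> ('b \<times> (nat \<Rightarrow> nat)) set) \<Rightarrow> (nat set \<Rightarrow> ('b \<times> (nat \<Rightarrow> nat)) set)" where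
  "cech_diff R M t D p \<phi> = (\<lambda>I\<in>cech_index D (Suc p).
     \<Oplus>\<^bsub>loc_module R M t I\<^esub>i\<in>I.
       add_pow (loc_module R M t I) ((- 1 :: int) ^ card {j \<in> I. j < i})
         (loc_map R M t I (\<lambda>m. m) (\<phi> (I - {i}))))"

definition cech_cocycles ::
    "('r, 'x) ring_scheme \<Rightarrow> ('r, 'b) module \<Rightarrow> (nat \<Rightarrow> 'r) \<Rightarrow> nat \<Rightarrow> nat \<Rightarrow>
      (nat set \<Rightarrow> ('b \<times> (nat \<Rightarrow> nat)) set) set" where
  "cech_cocycles R M t D p = {\<phi> \<in> cech R M t D p.
     \<forall>I\<in>cech_index D (Suc p). cech_diff R M t D p \<phi> I = \<zero>\<^bsub>loc_module R M t I\<^esub>}"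

text \<open>There are no cochains of negative degree, so in degree \<open>0\<close> cohomologous means equal.\<close>

fun cohomologous ::
    "('r, 'x) ring_scheme \<Rightarrow> ('r, 'b) module \<Rightarrow> (nat \<Rightarrow> 'r) \<Rightarrow> nat \<Rightarrow> nat \<Rightarrow>
      (nat set \<Rightarrow> ('b \<times> (nat \<Rightarrow> nat)) set) \<Rightarrow> (nat set \<Rightarrow> ('b \<times> (nat \<Rightarrow> nat)) set) \<Rightarrow> bool" where
  "cohomologous R M t D 0 \<phi> \<phi>' \<longleftrightarrow> \<phi>' = \<phi>"
| "cohomologous R M t D (Suc q) \<phi> \<phi>' \<longleftrightarrow> (\<exists>\<psi>\<in>cech R M t D q.
     \<forall>I\<in>cech_index D (Suc q).
       \<phi>' I = \<phi> I \<oplus>\<^bsub>loc_module R M t I\<^esub> cech_diff R M t D q \<psi> I)"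


section \<open>The group ring and stabilizer codes\<close>

text \<open>
  \<open>'n mod_ring\<close> is the ring of integers modulo \<open>n = CARD('n)\<close>. Since \<open>n = 1\<close> is allowed, the type
  class \<open>comm_ring_1\<close> (which requires \<open>0 \<noteq> 1\<close>) is not available, and units are given explicitly.
\<close>

definition Zn :: "'n::finite mod_ring ring" where
  "Zn = \<lparr>carrier = UNIV, monoid.mult = (*), one = of_int_mod_ring 1, zero = 0, add = (+)\<rparr>"

definition xpow :: "'g \<Rightarrow> 'g::ab_group_add \<Rightarrow>\<^sub>0 'n::finite mod_ring" where
  "xpow a = Poly_Mapping.single a (of_int_mod_ring 1)"

definition group_ring :: "('g::ab_group_add \<Rightarrow>\<^sub>0 'n::finite mod_ring) ring" where
  "group_ring = \<lparr>carrier = UNIV, monoid.mult = (*), one = xpow 0, zero = 0, add = (+)\<rparr>"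

definition antipode :: "('g::ab_group_add \<Rightarrow>\<^sub>0 'b::comm_monoid_add) \<Rightarrow> ('g \<Rightarrow>\<^sub>0 'b)" where
  "antipode r = (\<Sum>a\<in>Poly_Mapping.keys r. Poly_Mapping.single (- a) (Poly_Mapping.lookup r a))"

text \<open>
  The \<open>Zn\<close>-module \<open>P\<^sub>0\<close> is given by a type \<open>'p\<close> and its scalar multiplication \<open>s\<close>; the
  elements of \<open>P = P\<^sub>0[\<Lambda>]\<close> are the finitely supported functions from \<open>\<Lambda>\<close> to \<open>P\<^sub>0\<close>.
\<close>

definition local_module :: "('n::finite mod_ring \<Rightarrow> 'p \<Rightarrow> 'p) \<Rightarrow> ('n mod_ring, 'p::ab_group_add) module"
  where "local_module s = mk_module UNIV 0 (+) s"

definition pauli_smult ::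
    "('n::finite mod_ring \<Rightarrow> 'p \<Rightarrow> 'p) \<Rightarrow> ('g \<Rightarrow>\<^sub>0 'n mod_ring) \<Rightarrow> ('g \<Rightarrow>\<^sub>0 'p) \<Rightarrow>
      ('g::ab_group_add \<Rightarrow>\<^sub>0 'p::ab_group_add)" where
  "pauli_smult s r q = (\<Sum>a\<in>Poly_Mapping.keys r. \<Sum>b\<in>Poly_Mapping.keys q.
     Poly_Mapping.single (a + b) (s (Poly_Mapping.lookup r a) (Poly_Mapping.lookup q b)))"

definition pauli_module ::
    "('n::finite mod_ring \<Rightarrow> 'p \<Rightarrow> 'p) \<Rightarrow>
      ('g::ab_group_add \<Rightarrow>\<^sub>0 'n mod_ring, 'g \<Rightarrow>\<^sub>0 'p::ab_group_add) module" where
  "pauli_module s = mk_module UNIV 0 (+) (pauli_smult s)"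

definition omega ::
    "('p \<Rightarrow> 'p \<Rightarrow> 'n::finite mod_ring) \<Rightarrow> ('g \<Rightarrow>\<^sub>0 'p) \<Rightarrow> ('g \<Rightarrow>\<^sub>0 'p::ab_group_add) \<Rightarrow>
      ('g::ab_group_add \<Rightarrow>\<^sub>0 'n mod_ring)" where
  "omega w q q' = (\<Sum>a\<in>Poly_Mapping.keys q. \<Sum>b\<in>Poly_Mapping.keys q'.
     Poly_Mapping.single (b - a) (w (Poly_Mapping.lookup q a) (Poly_Mapping.lookup q' b)))"

locale stabilizer_code =
  fixes s :: "'n::finite mod_ring \<Rightarrow> 'p \<Rightarrow> 'p::ab_group_add"
    and w :: "'p \<Rightarrow> 'p \<Rightarrow> 'n mod_ring"
    and L :: "('g::ab_group_add \<Rightarrow>\<^sub>0 'p) set"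
  assumes lattice_fin_gen: "\<exists>S :: 'g set. finite S \<and> zmod.span S = UNIV"
    and local_module: "Module.module Zn (local_module s)"
    and local_fin_gen: "\<exists>S. finite S \<and>
      (\<forall>H. submodule H Zn (local_module s) \<and> S \<subseteq> H \<longrightarrow> H = UNIV)"
    and form_add_left: "w (a + b) c = w a c + w b c"
    and form_add_right: "w c (a + b) = w c a + w c b"
    and form_scale_left: "w (s r a) b = r * w a b"
    and form_scale_right: "w a (s r b) = r * w a b"
    and form_alternating: "w a a = 0"
    and form_nondegenerate: "(\<And>b. w b a = 0) \<Longrightarrow> a = 0"
    and submodule: "submodule L group_ring (pauli_module s)"
    and isotropic: "l \<in> L \<Longrightarrow> l' \<in> L \<Longrightarrow> omega w l l' = 0"

locale lagrangian_code = stabilizer_code +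
  assumes lagrangian: "L = {q. \<forall>l\<in>L. omega w l q = 0}"

definition code_quotient ::
    "('n::finite mod_ring \<Rightarrow> 'p \<Rightarrow> 'p) \<Rightarrow> ('g \<Rightarrow>\<^sub>0 'p) set \<Rightarrow>
      ('g::ab_group_add \<Rightarrow>\<^sub>0 'n mod_ring, ('g \<Rightarrow>\<^sub>0 'p::ab_group_add) set) module" where
  "code_quotient s L = quot_module (pauli_module s) L"

definition charge_module where
  "charge_module s L i =
    ext_module group_ring (i + 1) (twist_module antipode (code_quotient s L))
      (regular_module group_ring)"

text \<open>A cochain with values in \<open>P\<close> is a lift of one with values in \<open>P / L\<close>.\<close>

definition is_lift where
  "is_lift s L t D p \<phi>' \<phi> \<longleftrightarrow>
    \<phi>' \<in> cech group_ring (pauli_module s) t D p \<and>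
    (\<forall>I\<in>cech_index D p.
       loc_map group_ring (code_quotient s L) t I (\<lambda>q. L +>\<^bsub>pauli_module s\<^esub> q) (\<phi>' I) = \<phi> I)"


section \<open>Formal sums\<close>

text \<open>
  Formal sums are arbitrary functions on \<open>\<Lambda>\<close>. The product is meaningful when the sums
  below are finite.
\<close>

definition fs_mult ::
    "('g \<Rightarrow> 'n::finite mod_ring) \<Rightarrow> ('g \<Rightarrow> 'n mod_ring) \<Rightarrow> ('g::ab_group_add \<Rightarrow> 'n mod_ring)" where
  "fs_mult f g = (\<lambda>c. \<Sum>a\<in>{a. f a \<noteq> 0 \<and> g (c - a) \<noteq> 0}. f a * g (c - a))"

definition fs_one :: "'g::ab_group_add \<Rightarrow> 'n::finite mod_ring" where
  "fs_one = Poly_Mapping.lookup (xpow 0)"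

definition fs_smult ::
    "('n::finite mod_ring \<Rightarrow> 'p \<Rightarrow> 'p) \<Rightarrow> ('g \<Rightarrow>\<^sub>0 'p) \<Rightarrow> ('g \<Rightarrow> 'n mod_ring) \<Rightarrow>
      ('g::ab_group_add \<Rightarrow> 'p::ab_group_add)" where
  "fs_smult s q f = (\<lambda>c. \<Sum>a\<in>Poly_Mapping.keys q. s (f (c - a)) (Poly_Mapping.lookup q a))"

text \<open>
  The two expansions of \<open>1 / (1 - x\<^sup>g)\<close>, for a sign \<open>e\<close> equal to \<open>1\<close> or \<open>- 1\<close>. The coefficient
  sums are finite when \<open>g\<close> has infinite order.
\<close>

definition geom :: "'g \<Rightarrow> int \<Rightarrow> 'g::ab_group_add \<Rightarrow> 'n::finite mod_ring" where
  "geom g e = (if e = 1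
     then (\<lambda>a. \<Sum>j\<in>{j :: nat. zscale (int j) g = a}. of_int_mod_ring 1)
     else (\<lambda>a. - (\<Sum>j\<in>{j :: nat. j \<ge> 1 \<and> zscale (- int j) g = a}. of_int_mod_ring 1)))"

definition inv_tpow ::
    "(nat \<Rightarrow> 'g) \<Rightarrow> nat set \<Rightarrow> (nat \<Rightarrow> int) \<Rightarrow> (nat \<Rightarrow> nat) \<Rightarrow> ('g::ab_group_add \<Rightarrow> 'n::finite mod_ring)"
  where "inv_tpow \<gamma> I e k =
    foldr (\<lambda>i. fs_mult ((fs_mult (geom (\<gamma> i) (e i)) ^^ k i) fs_one)) (sorted_list_of_set I) fs_one"

text \<open>All representatives of a fraction give the same formal sum.\<close>

definition frac_expand ::
    "('n::finite mod_ring \<Rightarrow> 'p \<Rightarrow> 'p) \<Rightarrow> (nat \<Rightarrow> 'g) \<Rightarrow> nat set \<Rightarrow> (nat \<Rightarrow> int) \<Rightarrow>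
      (('g \<Rightarrow>\<^sub>0 'p) \<times> (nat \<Rightarrow> nat)) set \<Rightarrow> ('g::ab_group_add \<Rightarrow> 'p::ab_group_add)" where
  "frac_expand s \<gamma> I e X = the_elem ((\<lambda>(q, k). fs_smult s q (inv_tpow \<gamma> I e k)) ` X)"

definition Res ::
    "('n::finite mod_ring \<Rightarrow> 'p \<Rightarrow> 'p) \<Rightarrow> (nat \<Rightarrow> 'g) \<Rightarrow>
      (nat set \<Rightarrow> (('g \<Rightarrow>\<^sub>0 'p) \<times> (nat \<Rightarrow> nat)) set) \<Rightarrow> nat set \<Rightarrow> ('g::ab_group_add \<Rightarrow> 'p::ab_group_add)"
  where "Res s \<gamma> \<phi> I =
    (\<lambda>a. \<Sum>e\<in>I \<rightarrow>\<^sub>E {1, - 1}. zscale (\<Prod>i\<in>I. e i) (frac_expand s \<gamma> I e (\<phi> I) a))"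

text \<open>The extension of \<open>omega\<close> to formal sums in the second argument.\<close>

definition omega_hat ::
    "('p \<Rightarrow> 'p \<Rightarrow> 'n::finite mod_ring) \<Rightarrow> ('g \<Rightarrow>\<^sub>0 'p::ab_group_add) \<Rightarrow> ('g \<Rightarrow> 'p) \<Rightarrow>
      ('g::ab_group_add \<Rightarrow> 'n mod_ring)" where
  "omega_hat w q f = (\<lambda>c. \<Sum>a\<in>Poly_Mapping.keys q. w (Poly_Mapping.lookup q a) (f (a + c)))"

text \<open>The image of the tensor product of \<open>L\<close> with the module of formal sums.\<close>

definition formal_span ::
    "('n::finite mod_ring \<Rightarrow> 'p \<Rightarrow> 'p) \<Rightarrow> ('g \<Rightarrow>\<^sub>0 'p) set \<Rightarrow> ('g::ab_group_add \<Rightarrow> 'p::ab_group_add) set"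
  where "formal_span s L =
    {\<lambda>a. \<Sum>j<m. fs_smult s (l j) (f j) a | (m :: nat) l f. \<forall>j<m. l j \<in> L}"

definition preserves_state ::
    "('p \<Rightarrow> 'p \<Rightarrow> 'n::finite mod_ring) \<Rightarrow> ('g \<Rightarrow>\<^sub>0 'p) set \<Rightarrow> ('g::ab_group_add \<Rightarrow> 'p::ab_group_add) \<Rightarrow> bool"
  where "preserves_state w L \<theta> \<longleftrightarrow> (\<forall>l\<in>L. omega_hat w l \<theta> = (\<lambda>a. 0))"

definition extended_along :: "'g set \<Rightarrow> ('g::ab_group_add \<Rightarrow> 'p::ab_group_add) \<Rightarrow> bool" where
  "extended_along G \<theta> \<longleftrightarrow>
    (\<exists>F. finite F \<and> {a. \<theta> a \<noteq> 0} \<subseteq> {b + c | b c. b \<in> F \<and> c \<in> zmod.span G})"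

text \<open>
  A \<open>(D - p)\<close>-form symmetry: one state-preserving operator, extended in \<open>p\<close> directions, for each
  coordinate \<open>p\<close>-plane. In the top degree \<open>p = D\<close> every cochain is a cocycle, and \<open>Res\<close> need not
  preserve the state: take \<open>D = 1\<close>, \<open>n = 2\<close>, \<open>P\<close> free on \<open>X\<close>, \<open>Z\<close> with \<open>w X Z = 1\<close>, \<open>L = R Z\<close> and
  \<open>\<phi> = X / t\<close>.
\<close>

definition form_symmetry ::
    "('p \<Rightarrow> 'p \<Rightarrow> 'n::finite mod_ring) \<Rightarrow> ('g \<Rightarrow>\<^sub>0 'p) set \<Rightarrow> (nat \<Rightarrow> 'g) \<Rightarrow> nat \<Rightarrow> nat \<Rightarrow>
      (nat set \<Rightarrow> 'g::ab_group_add \<Rightarrow> 'p::ab_group_add) \<Rightarrow> bool" where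
  "form_symmetry w L \<gamma> D p \<theta> \<longleftrightarrow> (\<forall>I\<in>cech_index D p.
     extended_along (\<gamma> ` I) (\<theta> I) \<and> preserves_state w L (\<theta> I))"

end

(*
  Expanding a fraction in the direction given by the signs s is additive and linear over the group
  ring, because t_i times either expansion of 1/t_i is 1. It ignores s_i when t_i does not occur in
  the denominator, so the signed sum defining the residue kills every fraction coming from a smaller
  index set; in particular it kills coboundaries. A fraction over P that vanishes over P/L has a
  representative with numerator in L, which gives the statements about different lifts and
  cohomologous cocycles. For p < D choose an index i outside I: the coboundary of the lift on
  I + {i} is a fraction with numerator in L, hence pairs to zero with L, and in the signed sum over I
  all of its faces except the one indexed by I cancel.
*)

theory Submission
  imports Defs
begin

section \<open>Sums over the support of a finitely supported function\<close>

text \<open>Formal sums form a module over the group ring but not a ring. In one variable, with n >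
  1, the sum d of all powers x^j, j an integer, satisfies t d = 0; so (1/t)_+ (t d) = 0, although
  ((1/t)_+ t) d = d. This d is itself the residue of 1/t, so the failure cannot be avoided by
  excluding such elements. Cancelling t_i against an expansion of a product of several denominators
  therefore needs an argument. For a fixed choice of signs all factors are supported in the orthant
  spanned by the vectors \<plusminus>\<gamma>_i. Linear independence of the \<gamma>_i leaves each
  element only finitely many decompositions inside this orthant, and multiplication by t_i then
  commutes with the convolution of formal sums supported there. Expansions with different signs are
  only added, never multiplied.\<close>

definition pm_sum :: "('g \<Rightarrow> 'a::zero \<Rightarrow> 'b::comm_monoid_add) \<Rightarrow> ('g \<Rightarrow>\<^sub>0 'a) \<Rightarrow> 'b" where
  "pm_sum h q = (\<Sum>a\<in>Poly_Mapping.keys q. h a (Poly_Mapping.lookup q a))"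

text \<open>Supports can shrink under addition through cancellation. Additivity forces
  \<open>h a 0 = 0\<close>, so a sum over the support may be taken over any finite superset.\<close>

definition additive_in :: "('g \<Rightarrow> 'a::ab_group_add \<Rightarrow> 'b::ab_group_add) \<Rightarrow> bool" where
  "additive_in h \<longleftrightarrow> (\<forall>a x y. h a (x + y) = h a x + h a y)"

lemma additive_inI: "(\<And>a x y. h a (x + y) = h a x + h a y) \<Longrightarrow> additive_in h"
  by (simp add: additive_in_def)

lemma additive_in_zero: "additive_in h \<Longrightarrow> h a 0 = 0"
  unfolding additive_in_def by (metis add.right_neutral add_left_cancel)

lemma pm_sum_superset:
  assumes "additive_in h" "finite S" "Poly_Mapping.keys q \<subseteq> S"
  shows "pm_sum h q = (\<Sum>a\<in>S. h a (Poly_Mapping.lookup q a))"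
  unfolding pm_sum_def using assms
  by (intro sum.mono_neutral_left) (auto simp: in_keys_iff additive_in_zero)

lemma pm_sum_add:
  assumes "additive_in h"
  shows "pm_sum h (q + q') = pm_sum h q + pm_sum h q'"
proof -
  let ?S = "Poly_Mapping.keys q \<union> Poly_Mapping.keys q'"
  have "pm_sum h r = (\<Sum>a\<in>?S. h a (Poly_Mapping.lookup r a))"
    if "Poly_Mapping.keys r \<subseteq> ?S" for r
    using that assms by (intro pm_sum_superset) auto
  then show ?thesis
    using assms keys_add[of q q'] by (simp add: additive_in_def lookup_add sum.distrib)
qed

lemma pm_sum_zero [simp]: "pm_sum h 0 = 0"
  by (simp add: pm_sum_def)

lemma pm_sum_single: "additive_in h \<Longrightarrow> pm_sum h (Poly_Mapping.single a x) = h a x"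
  by (cases "x = 0") (auto simp: pm_sum_def additive_in_zero)

lemma pm_sum_sum:
  assumes "additive_in h"
  shows "pm_sum h (\<Sum>i\<in>A. q i) = (\<Sum>i\<in>A. pm_sum h (q i))"
  by (induction A rule: infinite_finite_induct) (simp_all add: pm_sum_add[OF assms])

text \<open>The products \<open>pauli_smult\<close>, \<open>omega\<close>, \<open>fs_smult\<close>
  and \<open>omega_hat\<close> are all sums of this kind, possibly nested; this rule and
  \<open>pm_sum_swap\<close> reduce the laws relating them to identities between summands.\<close>

lemma pm_sum_pm_sum:
  assumes "additive_in h"
  shows "pm_sum h (pm_sum g r) = pm_sum (\<lambda>a x. pm_sum h (g a x)) r"
  by (simp add: pm_sum_def[of g] pm_sum_def[of _ r] pm_sum_sum[OF assms])

lemma pm_sum_swap: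
  "pm_sum (\<lambda>a x. pm_sum (\<lambda>b y. h a x b y) q) r = pm_sum (\<lambda>b y. pm_sum (\<lambda>a x. h a x b y) r) q"
  unfolding pm_sum_def by (rule sum.swap)

lemma pm_sum_cong [cong]:
  "q = q' \<Longrightarrow> (\<And>a x. h a x = h' a x) \<Longrightarrow> pm_sum h q = pm_sum h' q'"
  by (simp add: pm_sum_def)

lemma pm_sum_distrib: "pm_sum (\<lambda>a x. h a x + h' a x) q = pm_sum h q + pm_sum h' q"
  by (simp add: pm_sum_def sum.distrib)

lemma pm_sum_hom:
  fixes f :: "'b::ab_group_add \<Rightarrow> 'c::ab_group_add" and q :: "'g \<Rightarrow>\<^sub>0 'a::zero"
  assumes "\<And>x y. f (x + y) = f x + f y"
  shows "f (pm_sum h q) = pm_sum (\<lambda>a x. f (h a x)) q"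
proof -
  have f0: "f 0 = 0" using assms by (metis add.right_neutral add_left_cancel)
  have "f (\<Sum>a\<in>A. g a) = (\<Sum>a\<in>A. f (g a))" for A :: "'g set" and g
    by (induction A rule: infinite_finite_induct) (simp_all add: assms f0)
  then show ?thesis by (simp add: pm_sum_def)
qed

lemma pm_sum_single_self: "pm_sum Poly_Mapping.single q = q"
proof (rule poly_mapping_eqI)
  fix c
  have "Poly_Mapping.lookup (pm_sum Poly_Mapping.single q) c
      = (\<Sum>a\<in>Poly_Mapping.keys q. if a = c then Poly_Mapping.lookup q a else 0)"
    by (auto simp: pm_sum_def lookup_sum lookup_single when_def intro: sum.cong)
  also have "\<dots> = Poly_Mapping.lookup q c"
    by (simp add: sum.delta' in_keys_iff)
  finally show "Poly_Mapping.lookup (pm_sum Poly_Mapping.single q) c = Poly_Mapping.lookup q c" .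
qed

section \<open>The group ring and its modules\<close>

text \<open>The computation with residues mod n also covers n = 1, where this unit is zero.\<close>

lemma unit_mod_ring [simp]: "of_int_mod_ring 1 * x = x" "x * of_int_mod_ring 1 = x"
  for x :: "'n::finite mod_ring"
proof -
  show "of_int_mod_ring 1 * x = x"
    by transfer (simp add: mod_mult_left_eq)
  then show "x * of_int_mod_ring 1 = x"
    by (simp add: mult.commute)
qed

lemma group_ring_simps [simp]:
  "carrier group_ring = UNIV" "r \<otimes>\<^bsub>group_ring\<^esub> r' = r * r'" "\<one>\<^bsub>group_ring\<^esub> = xpow 0"
  "\<zero>\<^bsub>group_ring\<^esub> = 0" "r \<oplus>\<^bsub>group_ring\<^esub> r' = r + r'"
  by (simp_all add: group_ring_def)

lemma xpow_0_mult: "xpow 0 * r = r" "r * xpow 0 = r"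
  for r :: "'g::ab_group_add \<Rightarrow>\<^sub>0 'n::finite mod_ring"
proof -
  have "Poly_Mapping.map ((*) (of_int_mod_ring 1)) r = r"
    by (rule poly_mapping_eqI) (simp add: map.rep_eq when_def)
  then show "xpow 0 * r = r"
    using mult_map_scale_conv_mult[of "of_int_mod_ring 1" r] by (simp add: xpow_def)
  then show "r * xpow 0 = r" by (simp add: mult.commute)
qed

lemma cring_group_ring: "cring (group_ring :: ('g::ab_group_add \<Rightarrow>\<^sub>0 'n::finite mod_ring) ring)"
proof (rule cringI)
  show "abelian_group (group_ring :: ('g \<Rightarrow>\<^sub>0 'n mod_ring) ring)"
    by (rule abelian_groupI) (auto simp: add_ac intro: exI[of _ "- _"])
  show "Group.comm_monoid (group_ring :: ('g \<Rightarrow>\<^sub>0 'n mod_ring) ring)"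
    by (rule comm_monoidI) (auto simp: mult_ac xpow_0_mult)
qed (simp add: distrib_right)

text \<open>The module laws of the local module as plain equations. Multiplication of Z_n on itself
  is another instance, so the lemmas about P and its formal sums hold for the group ring and its
  formal sums as well.\<close>

locale scalar_action =
  fixes s :: "'n::finite mod_ring \<Rightarrow> 'p \<Rightarrow> 'p::ab_group_add"
  assumes s_add_left: "s (r + r') x = s r x + s r' x"
    and s_add_right: "s r (x + y) = s r x + s r y"
    and s_mult: "s (r * r') x = s r (s r' x)"
    and s_one: "s (of_int_mod_ring 1) x = x"
begin

lemma s_zero_left [simp]: "s 0 x = 0"
  using s_add_left[of 0 0 x] by simp

lemma s_left_commute: "s r (s r' x) = s r' (s r x)"
  by (metis mult.commute s_mult)

lemma pauli_smult_eq: "pauli_smult s r q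
    = pm_sum (\<lambda>a x. pm_sum (\<lambda>b y. Poly_Mapping.single (a + b) (s x y)) q) r"
  by (simp add: pauli_smult_def pm_sum_def)

lemma pm_sum_pauli_smult:
  assumes "additive_in h"
  shows "pm_sum h (pauli_smult s r q) = pm_sum (\<lambda>a x. pm_sum (\<lambda>b y. h (a + b) (s x y)) q) r"
  by (simp add: pauli_smult_eq pm_sum_pm_sum[OF assms] pm_sum_single[OF assms])

lemma pauli_smult_add_right: "pauli_smult s r (q + q') = pauli_smult s r q + pauli_smult s r q'"
  unfolding pauli_smult_eq
  by (subst pm_sum_add)
    (auto intro!: additive_inI simp: s_add_right single_add pm_sum_distrib)

lemma pauli_smult_add_left: "pauli_smult s (r + r') q = pauli_smult s r q + pauli_smult s r' q"
  unfolding pauli_smult_eq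
  by (subst pm_sum_add)
    (auto intro!: additive_inI simp: s_add_left single_add pm_sum_distrib)

lemma pauli_smult_one: "pauli_smult s (xpow 0) q = q"
proof -
  have "pauli_smult s (xpow 0) q = pm_sum (\<lambda>b y. Poly_Mapping.single b y) q"
    unfolding pauli_smult_eq xpow_def
    by (subst pm_sum_single)
      (auto intro!: additive_inI simp: s_add_left single_add pm_sum_distrib s_one)
  then show ?thesis by (simp add: pm_sum_single_self)
qed

end

interpretation mod_ring_action: scalar_action "(*) :: 'n::finite mod_ring \<Rightarrow> _"
  by unfold_locales (simp_all add: algebra_simps)

text \<open>The group ring is the case of the local module Z_n; this puts both sides of the
  associativity law into the same nested-sum form.\<close>

lemma times_eq_pauli_smult: "r * r' = pauli_smult (*) r r'"
  for r :: "'g::ab_group_add \<Rightarrow>\<^sub>0 'n::finite mod_ring"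
proof -
  have "pm_sum Poly_Mapping.single r * pm_sum Poly_Mapping.single r' = pauli_smult (*) r r'"
    by (simp add: pm_sum_def pauli_smult_def sum_product mult_single)
  then show ?thesis by (simp add: pm_sum_single_self)
qed

context scalar_action
begin

lemma pauli_smult_assoc: "pauli_smult s (r * r') q = pauli_smult s r (pauli_smult s r' q)"
proof -
  have "pauli_smult s (r * r') q = pm_sum (\<lambda>a x. pm_sum (\<lambda>a' x'. pm_sum
      (\<lambda>b y. Poly_Mapping.single (a + a' + b) (s (x * x') y)) q) r') r"
    unfolding times_eq_pauli_smult pauli_smult_eq[of "pauli_smult _ _ _"]
    by (subst mod_ring_action.pm_sum_pauli_smult)
      (auto intro!: additive_inI simp: s_add_left single_add pm_sum_distrib)
  also have "\<dots> = pauli_smult s r (pauli_smult s r' q)"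
    unfolding pauli_smult_eq[of r]
    by (subst pm_sum_pauli_smult)
      (auto intro!: additive_inI simp: s_add_right single_add s_mult add.assoc)
  finally show ?thesis .
qed

lemma pauli_module_simps [simp]:
  "carrier (pauli_module s) = UNIV" "\<zero>\<^bsub>pauli_module s\<^esub> = 0"
  "q \<oplus>\<^bsub>pauli_module s\<^esub> q' = q + q'" "r \<odot>\<^bsub>pauli_module s\<^esub> q = pauli_smult s r q"
  by (simp_all add: pauli_module_def mk_module_def)

lemma module_pauli_module: "Module.module group_ring
    (pauli_module s :: ('g::ab_group_add \<Rightarrow>\<^sub>0 'n mod_ring, 'g \<Rightarrow>\<^sub>0 'p) module)"
proof (rule moduleI)
  show "abelian_group (pauli_module s :: ('g \<Rightarrow>\<^sub>0 'n mod_ring, 'g \<Rightarrow>\<^sub>0 'p) module)"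
    by (rule abelian_groupI) (auto simp: add_ac intro: exI[of _ "- _"])
qed (auto simp: cring_group_ring pauli_smult_add_left pauli_smult_add_right pauli_smult_assoc
       pauli_smult_one)

section \<open>Action of finitely supported elements on formal sums\<close>

lemma fs_smult_eq: "fs_smult s q f c = pm_sum (\<lambda>a y. s (f (c - a)) y) q"
  by (simp add: fs_smult_def pm_sum_def)

lemma fs_smult_add_left: "fs_smult s (q + q') f c = fs_smult s q f c + fs_smult s q' f c"
  unfolding fs_smult_eq by (subst pm_sum_add) (auto intro!: additive_inI simp: s_add_right)

lemma fs_smult_add_right: "fs_smult s q (\<lambda>a. f a + f' a) c = fs_smult s q f c + fs_smult s q f' c"
  by (simp add: fs_smult_eq s_add_left pm_sum_distrib)

lemma fs_smult_zero_left [simp]: "fs_smult s 0 f = (\<lambda>a. 0)"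
  by (simp add: fs_smult_def)

lemma fs_smult_zero_right [simp]: "fs_smult s q (\<lambda>a. 0) = (\<lambda>a. 0)"
  by (simp add: fs_smult_def)

lemma fs_smult_zscale_right: "fs_smult s q (\<lambda>a. zscale k (f a)) c = zscale k (fs_smult s q f c)"
proof -
  have neg: "fs_smult s q (\<lambda>a. - f a) c = - fs_smult s q f c" for f
    using fs_smult_add_right[of q f "\<lambda>a. - f a" c] by (simp add: add_eq_0_iff)
  have nat_case: "fs_smult s q (\<lambda>a. zscale (int m) (f a)) c = zscale (int m) (fs_smult s q f c)" for m
    by (induction m) (simp_all add: zscale_add_left zscale_nat fs_smult_add_right add.commute)
  show ?thesis
    by (cases k rule: int_cases2) (simp_all add: nat_case zscale_uminus neg)
qed

lemma fs_smult_sum_right: "fs_smult s q (\<lambda>a. \<Sum>i\<in>A. f i a) c = (\<Sum>i\<in>A. fs_smult s q (f i) c)"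
  by (induction A rule: infinite_finite_induct) (simp_all add: fs_smult_add_right)

lemma s_pm_sum_left: "s (pm_sum h q) y = pm_sum (\<lambda>a x. s (h a x) y) q"
  by (rule pm_sum_hom) (rule s_add_left)

text \<open>Balancing over the group ring: a scalar moves from the numerator into the formal sum.
  This is how factors t_i of a numerator reach the expanded denominators.\<close>

lemma fs_smult_pauli_smult: "fs_smult s (pauli_smult s r q) f = fs_smult s q (fs_smult (*) r f)"
proof
  fix c
  have "fs_smult s (pauli_smult s r q) f c
      = pm_sum (\<lambda>a x. pm_sum (\<lambda>b y. s (f (c - (a + b))) (s x y)) q) r"
    unfolding fs_smult_eq by (subst pm_sum_pauli_smult) (auto intro!: additive_inI simp: s_add_right)
  also have "\<dots> = pm_sum (\<lambda>b y. pm_sum (\<lambda>a x. s (f (c - b - a) * x) y) r) q"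
    by (subst pm_sum_swap) (simp add: s_mult s_left_commute algebra_simps)
  also have "\<dots> = fs_smult s q (fs_smult (*) r f) c"
    unfolding fs_smult_eq mod_ring_action.fs_smult_eq
    by (simp add: s_pm_sum_left)
  finally show "fs_smult s (pauli_smult s r q) f c = fs_smult s q (fs_smult (*) r f) c" .
qed

end

text \<open>Commutativity turns \<open>r * r'\<close> into \<open>r'\<close> acting on
  \<open>r\<close>, and the balancing law for the ring acting on itself applies.\<close>

lemma fs_smult_mult: "fs_smult (*) (r * r') f = fs_smult (*) r (fs_smult (*) r' f)"
  for f :: "'g::ab_group_add \<Rightarrow> 'n::finite mod_ring"
  by (metis mod_ring_action.fs_smult_pauli_smult mult.commute times_eq_pauli_smult)

lemma fs_smult_xpow: "fs_smult (*) (xpow g) f c = f (c - g)"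
  for f :: "'g::ab_group_add \<Rightarrow> 'n::finite mod_ring"
  unfolding mod_ring_action.fs_smult_eq xpow_def
  by (subst pm_sum_single) (auto intro!: additive_inI simp: algebra_simps)

text \<open>Multiplication by t is a difference operator, defined on every formal sum whatever its
  support.\<close>

lemma fs_smult_one_minus_xpow: "fs_smult (*) (xpow 0 - xpow g) f c = f c - f (c - g)"
  for f :: "'g::ab_group_add \<Rightarrow> 'n::finite mod_ring"
proof -
  have "fs_smult (*) (xpow 0 - xpow g) f c + fs_smult (*) (xpow g) f c = f c"
    using mod_ring_action.fs_smult_add_left[of "xpow 0 - xpow g" "xpow g" f c]
    by (simp add: fs_smult_xpow)
  then show ?thesis by (simp add: fs_smult_xpow algebra_simps)
qed

section \<open>The pairing of P with formal sums\<close>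

locale form_action = scalar_action s for s :: "'n::finite mod_ring \<Rightarrow> 'p \<Rightarrow> 'p::ab_group_add" +
  fixes w :: "'p \<Rightarrow> 'p \<Rightarrow> 'n mod_ring"
  assumes w_add_right: "w c (a + b) = w c a + w c b"
    and w_scale_right: "w a (s r b) = r * w a b"
begin

lemma omega_hat_eq: "omega_hat w l f c = pm_sum (\<lambda>a x. w x (f (a + c))) l"
  by (simp add: omega_hat_def pm_sum_def)

lemma omega_eq: "omega w l q
    = pm_sum (\<lambda>a x. pm_sum (\<lambda>b y. Poly_Mapping.single (b - a) (w x y)) q) l"
  by (simp add: omega_def pm_sum_def)

lemma omega_hat_add: "omega_hat w l (\<lambda>a. f a + f' a) c = omega_hat w l f c + omega_hat w l f' c"
  by (simp add: omega_hat_eq w_add_right pm_sum_distrib)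

lemma w_pm_sum_right: "w x (pm_sum h q) = pm_sum (\<lambda>a y. w x (h a y)) q"
  by (rule pm_sum_hom) (rule w_add_right)

text \<open>Linearity over formal sums is what makes a fraction pair to zero with \<open>l\<close>,
  in every expansion, as soon as its numerator does. The shifts match because c - (b - a) = (a + c)
  - b.\<close>

lemma omega_hat_fs_smult: "omega_hat w l (fs_smult s q f) = fs_smult (*) (omega w l q) f"
proof
  fix c
  have "omega_hat w l (fs_smult s q f) c
      = pm_sum (\<lambda>a x. pm_sum (\<lambda>b y. f (c - (b - a)) * w x y) q) l"
    unfolding omega_hat_eq fs_smult_eq
    by (simp add: w_pm_sum_right w_scale_right algebra_simps)
  also have "\<dots> = fs_smult (*) (omega w l q) f c"
    unfolding mod_ring_action.fs_smult_eq omega_eq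
    by (simp add: pm_sum_pm_sum pm_sum_single additive_inI distrib_left)
  finally show "omega_hat w l (fs_smult s q f) c = fs_smult (*) (omega w l q) f c" .
qed

lemma omega_hat_zero: "omega_hat w l (\<lambda>a. 0) c = 0"
  using omega_hat_add[of l "\<lambda>a. 0" "\<lambda>a. 0" c] by simp

lemma omega_hat_zscale: "omega_hat w l (\<lambda>a. zscale k (f a)) c = zscale k (omega_hat w l f c)"
proof -
  have neg: "omega_hat w l (\<lambda>a. - f a) c = - omega_hat w l f c" for f
    using omega_hat_add[of l f "\<lambda>a. - f a" c] omega_hat_zero[of l c]
    by (simp add: eq_neg_iff_add_eq_0 add.commute)
  have nat_case: "omega_hat w l (\<lambda>a. zscale (int m) (f a)) c = zscale (int m) (omega_hat w l f c)" for m
    by (induction m) (simp_all add: zscale_add_left zscale_nat omega_hat_add omega_hat_zero)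
  show ?thesis
    by (cases k rule: int_cases2) (simp_all add: nat_case zscale_uminus neg)
qed

lemma omega_hat_sum: "omega_hat w l (\<lambda>a. \<Sum>i\<in>A. f i a) c = (\<Sum>i\<in>A. omega_hat w l (f i) c)"
  by (induction A rule: infinite_finite_induct) (simp_all add: omega_hat_add omega_hat_zero)

end

section \<open>Additive maps\<close>

lemma abelian_group_hom_int_pow:
  assumes "abelian_group G" "abelian_group H" "f \<in> hom (add_monoid G) (add_monoid H)" "x \<in> carrier G"
  shows "f (add_pow G (k :: int) x) = add_pow H k (f x)"
  unfolding add_pow_def using assms
  by (intro hom_int_pow) (auto intro: abelian_group.a_group)

lemma abelian_group_hom_zero:
  assumes "abelian_group G" "abelian_group H" "f \<in> hom (add_monoid G) (add_monoid H)"
  shows "f \<zero>\<^bsub>G\<^esub> = \<zero>\<^bsub>H\<^esub>"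
  using assms hom_one[of f "add_monoid G" "add_monoid H"] by (auto intro: abelian_group.a_group)

lemma abelian_group_hom_finsum:
  assumes "abelian_group G" "abelian_group H" "f \<in> hom (add_monoid G) (add_monoid H)"
    and "g \<in> A \<rightarrow> carrier G"
  shows "f (finsum G g A) = finsum H (\<lambda>i. f (g i)) A"
proof -
  interpret G: abelian_group G by fact
  interpret H: abelian_group H by fact
  have f: "f x \<in> carrier H" "f (x \<oplus>\<^bsub>G\<^esub> y) = f x \<oplus>\<^bsub>H\<^esub> f y" if "x \<in> carrier G" "y \<in> carrier G" for x y
    using assms(3) that by (auto simp: hom_def)
  show ?thesis
    using assms(4)
  proof (induction A rule: infinite_finite_induct)
    case (insert i A)
    then have "g i \<in> carrier G" "g \<in> A \<rightarrow> carrier G" by auto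
    with insert show ?case by (simp add: f Pi_iff)
  qed (simp_all add: abelian_group_hom_zero[OF assms(1-3)])
qed

text \<open>From here on the target is a type of class \<open>ab_group_add\<close> instead of a
  group record: residues and pairings lead from a localization into such types.\<close>

lemma additive_zero:
  fixes h :: "'a \<Rightarrow> 'b::ab_group_add"
  assumes "abelian_group G"
    and add: "\<And>x y. x \<in> carrier G \<Longrightarrow> y \<in> carrier G \<Longrightarrow> h (x \<oplus>\<^bsub>G\<^esub> y) = h x + h y"
  shows "h \<zero>\<^bsub>G\<^esub> = 0"
proof -
  interpret abelian_group G by fact
  show ?thesis using add[OF zero_closed zero_closed] by simp
qed

lemma additive_finsum:
  fixes h :: "'a \<Rightarrow> 'b::ab_group_add"
  assumes "abelian_group G"
    and add: "\<And>x y. x \<in> carrier G \<Longrightarrow> y \<in> carrier G \<Longrightarrow> h (x \<oplus>\<^bsub>G\<^esub> y) = h x + h y"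
    and "g \<in> A \<rightarrow> carrier G"
  shows "h (finsum G g A) = (\<Sum>i\<in>A. h (g i))"
proof -
  interpret abelian_group G by fact
  show ?thesis
    using assms(3)
  proof (induction A rule: infinite_finite_induct)
    case (insert i A)
    then have "g i \<in> carrier G" "g \<in> A \<rightarrow> carrier G" by auto
    with insert show ?case by (simp add: add)
  qed (simp_all add: additive_zero[OF assms(1) add])
qed

lemma additive_add_pow:
  fixes h :: "'a \<Rightarrow> 'b::ab_group_add"
  assumes "abelian_group G"
    and add: "\<And>x y. x \<in> carrier G \<Longrightarrow> y \<in> carrier G \<Longrightarrow> h (x \<oplus>\<^bsub>G\<^esub> y) = h x + h y"
    and x: "x \<in> carrier G"
  shows "h (add_pow G (k :: int) x) = zscale k (h x)"
proof -
  interpret abelian_group G by fact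
  have nat_case: "h (add_pow G m x) = (\<Sum>i<m. h x)" for m :: nat
    by (induction m) (simp_all add: x add additive_zero[OF assms(1) add])
  have neg: "h (\<ominus>\<^bsub>G\<^esub> y) = - h y" if "y \<in> carrier G" for y
    using add[of y "\<ominus>\<^bsub>G\<^esub> y"] that additive_zero[OF assms(1) add]
    by (simp add: r_neg eq_neg_iff_add_eq_0 add.commute)
  show ?thesis
  proof (cases "k \<ge> 0")
    case True
    then show ?thesis by (simp add: add_pow_int_ge nat_case zscale_nat[symmetric])
  next
    case False
    then show ?thesis
      using zscale_uminus[of "- k" "h x"] by (simp add: add_pow_int_lt nat_case neg x zscale_nat[symmetric])
  qed
qed

text \<open>The difference is written as a summand \<open>z\<close>, so that additivity of residues
  applies directly and only an element of the kernel remains to be studied.\<close>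

lemma abelian_group_eq_addI:
  assumes "abelian_group G" "abelian_group H" "f \<in> hom (add_monoid G) (add_monoid H)"
    and xy: "x \<in> carrier G" "y \<in> carrier G" "f x = f y"
  obtains z where "z \<in> carrier G" "f z = \<zero>\<^bsub>H\<^esub>" "x = y \<oplus>\<^bsub>G\<^esub> z"
proof
  interpret G: abelian_group G by fact
  interpret H: abelian_group H by fact
  let ?z = "\<ominus>\<^bsub>G\<^esub> y \<oplus>\<^bsub>G\<^esub> x"
  show z: "?z \<in> carrier G" using xy by simp
  show x: "x = y \<oplus>\<^bsub>G\<^esub> ?z" using xy by (simp add: G.a_assoc[symmetric] G.r_neg)
  have "f x = f y \<oplus>\<^bsub>H\<^esub> f ?z"
    using assms(3) z xy by (subst x) (simp add: hom_def)
  moreover have "f x \<in> carrier H" "f ?z \<in> carrier H"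
    using assms(3) z xy by (auto simp: hom_def)
  ultimately show "f ?z = \<zero>\<^bsub>H\<^esub>"
    using xy(3) by (metis H.add.r_cancel_one' H.a_comm)
qed

text \<open>Operations on cosets and fractions are unions over representatives; once the result does
  not depend on the representative, any one of them computes the union.\<close>

lemma UN_const_on:
  assumes "a \<in> X" "\<And>b. b \<in> X \<Longrightarrow> F b = c"
  shows "(\<Union>b\<in>X. F b) = c"
proof -
  have "(\<Union>b\<in>X. F b) = (\<Union>b\<in>X. c)" by (rule SUP_cong[OF refl assms(2)])
  then show ?thesis using assms(1) by auto
qed

section \<open>Quotient modules\<close>

text \<open>Each axiom of \<open>N\<close> is the image of the same axiom of \<open>M\<close>, which
  spares the verification on cosets.\<close>

lemma module_surj_image:
  fixes N :: "('r, 'c) module"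
  assumes "Module.module R M"
    and surj: "f ` carrier M = carrier N"
    and zero: "f \<zero>\<^bsub>M\<^esub> = \<zero>\<^bsub>N\<^esub>"
    and add: "\<And>x y. x \<in> carrier M \<Longrightarrow> y \<in> carrier M \<Longrightarrow> f (x \<oplus>\<^bsub>M\<^esub> y) = f x \<oplus>\<^bsub>N\<^esub> f y"
    and smult: "\<And>r x. r \<in> carrier R \<Longrightarrow> x \<in> carrier M \<Longrightarrow> f (r \<odot>\<^bsub>M\<^esub> x) = r \<odot>\<^bsub>N\<^esub> f x"
  shows "Module.module R N"
proof -
  interpret Module.module R M by fact
  note [simp] = add[symmetric] smult[symmetric] zero[symmetric]
  have ex: "\<exists>x\<in>carrier M. y = f x" if "y \<in> carrier N" for y
    using that surj by auto
  have closed [simp]: "f x \<in> carrier N" if "x \<in> carrier M" for x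
    using that surj by auto
  show ?thesis
  proof (rule moduleI)
    show "cring R" by (rule is_cring)
    show "abelian_group N"
    proof (rule abelian_groupI)
      fix x assume "x \<in> carrier N"
      then obtain u where "u \<in> carrier M" "x = f u" using ex by blast
      then show "\<exists>y\<in>carrier N. y \<oplus>\<^bsub>N\<^esub> x = \<zero>\<^bsub>N\<^esub>"
        by (intro bexI[of _ "f (\<ominus>\<^bsub>M\<^esub> u)"]) (simp_all add: M.l_neg)
    qed (auto dest!: ex simp: M.a_ac)
  qed (auto dest!: ex simp: smult_l_distr smult_r_distr smult_assoc1)
qed

lemma abelian_subgroup_submodule:
  assumes "Module.module R M" "submodule H R M"
  shows "abelian_subgroup H M"
  using assms by (intro abelian_subgroupI3)
    (auto simp: additive_subgroup_def submodule_def Module.module_def)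

lemma quot_module_simps:
  "carrier (quot_module M H) = a_rcosets\<^bsub>M\<^esub> H" "\<zero>\<^bsub>quot_module M H\<^esub> = H"
  "X \<oplus>\<^bsub>quot_module M H\<^esub> Y = X <+>\<^bsub>M\<^esub> Y"
  "r \<odot>\<^bsub>quot_module M H\<^esub> X = (\<Union>x\<in>X. H +>\<^bsub>M\<^esub> (r \<odot>\<^bsub>M\<^esub> x))"
  by (simp_all add: quot_module_def mk_module_def)

lemma quot_map_surj: "(\<lambda>x. H +>\<^bsub>M\<^esub> x) ` carrier M = carrier (quot_module M H)"
  by (auto simp: quot_module_simps A_RCOSETS_def RCOSETS_def a_r_coset_def)

lemma quot_map_smult:
  assumes "Module.module R M" "submodule H R M" "r \<in> carrier R" "x \<in> carrier M"
  shows "H +>\<^bsub>M\<^esub> (r \<odot>\<^bsub>M\<^esub> x) = r \<odot>\<^bsub>quot_module M H\<^esub> (H +>\<^bsub>M\<^esub> x)"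
proof -
  interpret Module.module R M by fact
  interpret abelian_subgroup H M by (rule abelian_subgroup_submodule) fact+
  have "H +>\<^bsub>M\<^esub> (r \<odot>\<^bsub>M\<^esub> y) = H +>\<^bsub>M\<^esub> (r \<odot>\<^bsub>M\<^esub> x)" if y: "y \<in> H +>\<^bsub>M\<^esub> x" for y
  proof -
    obtain h where h: "h \<in> H" "y = h \<oplus>\<^bsub>M\<^esub> x"
      using y by (auto simp: a_r_coset_def')
    then have "r \<odot>\<^bsub>M\<^esub> y = r \<odot>\<^bsub>M\<^esub> h \<oplus>\<^bsub>M\<^esub> r \<odot>\<^bsub>M\<^esub> x" "r \<odot>\<^bsub>M\<^esub> h \<in> H"
      using assms a_subset submodule.smult_closed[OF assms(2)] by (auto simp: smult_r_distr)
    then have "r \<odot>\<^bsub>M\<^esub> y \<in> H +>\<^bsub>M\<^esub> (r \<odot>\<^bsub>M\<^esub> x)"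
      by (auto simp: a_r_coset_def')
    then show ?thesis using a_repr_independence' assms by simp
  qed
  moreover have "x \<in> H +>\<^bsub>M\<^esub> x" using assms a_rcos_self by simp
  ultimately show ?thesis
    unfolding quot_module_simps by (intro UN_const_on[symmetric])
qed

lemma quot_map_add:
  assumes "Module.module R M" "submodule H R M" "x \<in> carrier M" "y \<in> carrier M"
  shows "H +>\<^bsub>M\<^esub> (x \<oplus>\<^bsub>M\<^esub> y) = (H +>\<^bsub>M\<^esub> x) \<oplus>\<^bsub>quot_module M H\<^esub> (H +>\<^bsub>M\<^esub> y)"
proof -
  interpret abelian_subgroup H M by (rule abelian_subgroup_submodule) fact+
  show ?thesis using assms by (simp add: quot_module_simps a_rcos_sum)
qed

lemma quot_map_eq_zero_iff:
  assumes "Module.module R M" "submodule H R M" "x \<in> carrier M"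
  shows "H +>\<^bsub>M\<^esub> x = \<zero>\<^bsub>quot_module M H\<^esub> \<longleftrightarrow> x \<in> H"
proof -
  interpret abelian_subgroup H M by (rule abelian_subgroup_submodule) fact+
  show ?thesis
    using assms(3) a_rcos_self a_coset_join2 a_subgroup by (auto simp: quot_module_simps)
qed

lemma module_quot_module:
  assumes "Module.module R M" "submodule H R M"
  shows "Module.module R (quot_module M H)"
proof -
  interpret Module.module R M by fact
  interpret abelian_subgroup H M by (rule abelian_subgroup_submodule) fact+
  show ?thesis
    by (rule module_surj_image[OF assms(1) quot_map_surj])
      (use assms in \<open>auto simp: quot_map_eq_zero_iff quot_map_add quot_map_smult\<close>)
qed

section \<open>Localization\<close>

lemma exponents_add: "k \<in> exponents I \<Longrightarrow> k' \<in> exponents I \<Longrightarrow> (\<lambda>i. k i + k' i) \<in> exponents I"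
  by (simp add: exponents_def)

lemma exponents_zero: "(\<lambda>i. 0) \<in> exponents I"
  by (simp add: exponents_def)

lemma exponents_mono: "I \<subseteq> J \<Longrightarrow> exponents I \<subseteq> exponents J"
  by (auto simp: exponents_def)

lemmas exponents_intros [simp] = exponents_add exponents_zero

locale localization = Module.module R M
  for R :: "('r, 'x) ring_scheme" (structure) and M :: "('r, 'b) module" (structure) +
  fixes t :: "nat \<Rightarrow> 'r"
  assumes t_closed [simp]: "t i \<in> carrier R"
begin

abbreviation frac where "frac I \<equiv> loc_frac R M t I"
abbreviation loc where "loc I \<equiv> loc_module R M t I"
abbreviation T where "T I k m \<equiv> tpow R t I k \<odot>\<^bsub>M\<^esub> m"

lemma tpow_closed [simp, intro]: "tpow R t I k \<in> carrier R"
  by (simp add: tpow_def)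

lemma tpow_add: "tpow R t I (\<lambda>i. k i + k' i) = tpow R t I k \<otimes> tpow R t I k'"
  by (simp add: tpow_def R.nat_pow_mult[symmetric] R.finprod_multf)

lemma tpow_zero: "tpow R t I (\<lambda>i. 0) = \<one>"
  by (simp add: tpow_def)

lemma tpow_mono:
  assumes "finite J" "I \<subseteq> J" "k \<in> exponents I"
  shows "tpow R t J k = tpow R t I k"
  unfolding tpow_def using assms
  by (intro R.finprod_mono_neutral_cong_right) (auto simp: exponents_def)

lemma T_commute: "r \<in> carrier R \<Longrightarrow> r' \<in> carrier R \<Longrightarrow> m \<in> carrier M \<Longrightarrow>
    r \<odot>\<^bsub>M\<^esub> (r' \<odot>\<^bsub>M\<^esub> m) = r' \<odot>\<^bsub>M\<^esub> (r \<odot>\<^bsub>M\<^esub> m)"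
  by (metis R.m_comm smult_assoc1)

lemma T_add: "m \<in> carrier M \<Longrightarrow> T I (\<lambda>i. k i + k' i) m = T I k (T I k' m)"
  by (simp add: tpow_add smult_assoc1)

lemmas T_simps = T_add tpow_zero smult_r_distr M.a_ac T_commute

text \<open>The definition kills a difference; in the form of an equation the relation can be
  handled by rewriting with \<open>T_simps\<close>.\<close>

lemma loc_rel_iff: "((m, k), (m', k')) \<in> loc_rel R M t I \<longleftrightarrow>
    m \<in> carrier M \<and> m' \<in> carrier M \<and> k \<in> exponents I \<and> k' \<in> exponents I \<and>
    (\<exists>j\<in>exponents I. T I j (T I k' m) = T I j (T I k m'))"
proof -
  have "r \<odot>\<^bsub>M\<^esub> (x \<ominus>\<^bsub>M\<^esub> y) = \<zero>\<^bsub>M\<^esub> \<longleftrightarrow> r \<odot>\<^bsub>M\<^esub> x = r \<odot>\<^bsub>M\<^esub> y"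
    if "r \<in> carrier R" "x \<in> carrier M" "y \<in> carrier M" for r x y
    using that
    by (simp add: a_minus_def smult_r_distr smult_r_minus)
      (metis M.add.inv_closed M.minus_equality M.minus_minus M.r_neg smult_closed)
  then show ?thesis by (auto simp: loc_rel_def)
qed

lemma equiv_loc_rel: "equiv (carrier M \<times> exponents I) (loc_rel R M t I)"
proof (rule equivI)
  show "loc_rel R M t I \<subseteq> (carrier M \<times> exponents I) \<times> carrier M \<times> exponents I"
    by (auto simp: loc_rel_def)
  show "refl_on (carrier M \<times> exponents I) (loc_rel R M t I)"
    by (auto simp: refl_on_def loc_rel_iff)
  show "sym (loc_rel R M t I)"
    by (auto simp: sym_def loc_rel_iff) metis
  show "trans (loc_rel R M t I)"
  proof (rule transI, clarify)
    fix m k m' k' m'' k''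
    assume "((m, k), (m', k')) \<in> loc_rel R M t I" "((m', k'), (m'', k'')) \<in> loc_rel R M t I"
    then obtain j j' where
      [simp]: "m \<in> carrier M" "m' \<in> carrier M" "m'' \<in> carrier M" and
      [simp]: "k \<in> exponents I" "k' \<in> exponents I" "k'' \<in> exponents I"
        "j \<in> exponents I" "j' \<in> exponents I" and
      1: "T I j (T I k' m) = T I j (T I k m')" and 2: "T I j' (T I k'' m') = T I j' (T I k' m'')"
      by (auto simp: loc_rel_iff)
    \<comment> \<open>The factor t^k' brings in the middle numerator m'. Powers of t may be zero
      divisors on M, so this factor cannot be cancelled afterwards and stays in the witness.\<close>
    have "T I (\<lambda>i. j i + j' i + k' i) (T I k'' m) = T I j' (T I k'' (T I j (T I k' m)))"
      by (simp add: T_simps)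
    also have "\<dots> = T I j (T I k (T I j' (T I k'' m')))"
      unfolding 1 by (simp add: T_simps)
    also have "\<dots> = T I (\<lambda>i. j i + j' i + k' i) (T I k m'')"
      unfolding 2 by (simp add: T_simps)
    finally show "((m, k), (m'', k'')) \<in> loc_rel R M t I"
      by (auto simp: loc_rel_iff intro!: bexI[of _ "\<lambda>i. j i + j' i + k' i"])
  qed
qed

lemma frac_eq_iff:
  assumes "m \<in> carrier M" "m' \<in> carrier M" "k \<in> exponents I" "k' \<in> exponents I"
  shows "frac I m k = frac I m' k' \<longleftrightarrow> (\<exists>j\<in>exponents I. T I j (T I k' m) = T I j (T I k m'))"
  using eq_equiv_class_iff[OF equiv_loc_rel, of "(m, k)" I "(m', k')"] assms
  by (simp add: loc_frac_def loc_rel_iff)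

lemma frac_eqI:
  assumes "m \<in> carrier M" "m' \<in> carrier M" "k \<in> exponents I" "k' \<in> exponents I"
    and "T I k' m = T I k m'"
  shows "frac I m k = frac I m' k'"
  using assms frac_eq_iff by auto

lemma mem_frac_iff:
  assumes "m \<in> carrier M" "k \<in> exponents I"
  shows "(m', k') \<in> frac I m k \<longleftrightarrow>
    m' \<in> carrier M \<and> k' \<in> exponents I \<and> frac I m' k' = frac I m k"
proof -
  have "(m', k') \<in> frac I m k \<longleftrightarrow> ((m, k), (m', k')) \<in> loc_rel R M t I"
    by (simp add: loc_frac_def)
  also have "\<dots> \<longleftrightarrow> m' \<in> carrier M \<and> k' \<in> exponents I \<and> frac I m k = frac I m' k'"
    using assms by (simp add: loc_rel_iff frac_eq_iff cong: conj_cong)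
  finally show ?thesis by metis
qed

lemma frac_self [simp]: "m \<in> carrier M \<Longrightarrow> k \<in> exponents I \<Longrightarrow> (m, k) \<in> frac I m k"
  by (simp add: mem_frac_iff)

lemma loc_zero: "\<zero>\<^bsub>loc I\<^esub> = frac I \<zero>\<^bsub>M\<^esub> (\<lambda>i. 0)"
  by (simp add: loc_module_def mk_module_def)

lemma frac_zero: "k \<in> exponents I \<Longrightarrow> frac I \<zero>\<^bsub>M\<^esub> k = \<zero>\<^bsub>loc I\<^esub>"
  unfolding loc_zero by (rule frac_eqI) auto

lemma loc_carrier: "X \<in> carrier (loc I) \<longleftrightarrow> (\<exists>m\<in>carrier M. \<exists>k\<in>exponents I. X = frac I m k)"
  by (auto simp: loc_module_def mk_module_def quotient_def loc_frac_def)

lemma frac_closed [simp, intro]: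
  "m \<in> carrier M \<Longrightarrow> k \<in> exponents I \<Longrightarrow> frac I m k \<in> carrier (loc I)"
  by (auto simp: loc_carrier)

lemma frac_add:
  assumes [simp]: "m \<in> carrier M" "m' \<in> carrier M" "k \<in> exponents I" "k' \<in> exponents I"
  shows "frac I m k \<oplus>\<^bsub>loc I\<^esub> frac I m' k'
    = frac I (T I k' m \<oplus>\<^bsub>M\<^esub> T I k m') (\<lambda>i. k i + k' i)"
proof -
  let ?F = "\<lambda>(m, k) (m', k'). frac I (T I k' m \<oplus>\<^bsub>M\<^esub> T I k m') (\<lambda>i. k i + k' i)"
  have F: "?F (n, l) (n', l') = ?F (m, k) (m', k')"
    if n: "(n, l) \<in> frac I m k" "(n', l') \<in> frac I m' k'" for n l n' l'
  proof -
    have [simp]: "n \<in> carrier M" "l \<in> exponents I" "n' \<in> carrier M" "l' \<in> exponents I"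
      using n by (auto simp: mem_frac_iff)
    obtain j j' where
      [simp]: "j \<in> exponents I" "j' \<in> exponents I" and
      1: "T I j (T I k n) = T I j (T I l m)" and 2: "T I j' (T I k' n') = T I j' (T I l' m')"
      using n by (auto simp: mem_frac_iff frac_eq_iff)
    \<comment> \<open>Each of the two equivalences has its own witness; the sum j + j' serves both
      summands.\<close>
    have "T I (\<lambda>i. j i + j' i) (T I (\<lambda>i. k i + k' i) (T I l' n \<oplus>\<^bsub>M\<^esub> T I l n'))
        = T I j' (T I k' (T I l' (T I j (T I k n)))) \<oplus>\<^bsub>M\<^esub> T I j (T I k (T I l (T I j' (T I k' n'))))"
      by (simp add: T_simps)
    also have "\<dots> = T I (\<lambda>i. j i + j' i) (T I (\<lambda>i. l i + l' i) (T I k' m \<oplus>\<^bsub>M\<^esub> T I k m'))"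
      unfolding 1 2 by (simp add: T_simps)
    finally show ?thesis
      by (auto simp: frac_eq_iff intro!: bexI[of _ "\<lambda>i. j i + j' i"])
  qed
  have "frac I m k \<oplus>\<^bsub>loc I\<^esub> frac I m' k' = (\<Union>a\<in>frac I m k. \<Union>b\<in>frac I m' k'. ?F a b)"
    by (auto simp: loc_module_def mk_module_def)
  also have "\<dots> = ?F (m, k) (m', k')"
  proof (intro UN_const_on[OF frac_self] assms)
    show "?F a b = ?F (m, k) (m', k')" if "a \<in> frac I m k" "b \<in> frac I m' k'" for a b
      using F[of "fst a" "snd a" "fst b" "snd b"] that by (simp add: case_prod_beta)
  qed
  finally show ?thesis by simp
qed

lemma abelian_group_loc: "abelian_group (loc I)"
proof (rule abelian_groupI)
  fix X assume "X \<in> carrier (loc I)"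
  then obtain m k where X: "m \<in> carrier M" "k \<in> exponents I" "X = frac I m k"
    by (auto simp: loc_carrier)
  then show "\<exists>Y\<in>carrier (loc I). Y \<oplus>\<^bsub>loc I\<^esub> X = \<zero>\<^bsub>loc I\<^esub>"
    by (intro bexI[of _ "frac I (\<ominus>\<^bsub>M\<^esub> m) k"])
      (simp_all add: frac_add smult_r_minus M.l_neg frac_zero)
  show "\<zero>\<^bsub>loc I\<^esub> \<oplus>\<^bsub>loc I\<^esub> X = X"
    using X by (auto simp: frac_add loc_zero tpow_zero)
next
  fix X Y Z assume "X \<in> carrier (loc I)" "Y \<in> carrier (loc I)" "Z \<in> carrier (loc I)"
  then show "(X \<oplus>\<^bsub>loc I\<^esub> Y) \<oplus>\<^bsub>loc I\<^esub> Z = X \<oplus>\<^bsub>loc I\<^esub> (Y \<oplus>\<^bsub>loc I\<^esub> Z)"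
    by (auto simp: loc_carrier frac_add T_simps add.assoc)
next
  fix X Y assume XY: "X \<in> carrier (loc I)" "Y \<in> carrier (loc I)"
  then show "X \<oplus>\<^bsub>loc I\<^esub> Y \<in> carrier (loc I)"
    by (auto simp: loc_carrier frac_add)
       (metis M.a_closed exponents_add smult_closed tpow_closed)
  from XY show "X \<oplus>\<^bsub>loc I\<^esub> Y = Y \<oplus>\<^bsub>loc I\<^esub> X"
    by (auto simp: loc_carrier frac_add T_simps add.commute)
qed (auto simp: loc_zero)

end

section \<open>Functoriality of localization\<close>

locale localization_hom = M: localization R M t + N: localization R N t
  for R :: "('r, 'x) ring_scheme" (structure) and M :: "('r, 'b) module"
    and N :: "('r, 'c) module" and t +
  fixes f :: "'b \<Rightarrow> 'c"
  assumes f_closed [simp]: "m \<in> carrier M \<Longrightarrow> f m \<in> carrier N"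
    and f_add: "m \<in> carrier M \<Longrightarrow> m' \<in> carrier M \<Longrightarrow> f (m \<oplus>\<^bsub>M\<^esub> m') = f m \<oplus>\<^bsub>N\<^esub> f m'"
    and f_smult: "r \<in> carrier R \<Longrightarrow> m \<in> carrier M \<Longrightarrow> f (r \<odot>\<^bsub>M\<^esub> m) = r \<odot>\<^bsub>N\<^esub> f m"
begin

text \<open>A witness for equality over the smaller index set \<open>I\<close> remains one over
  \<open>J\<close>, since exponents supported in \<open>I\<close> give the same power of t on both
  sets.\<close>

lemma loc_map_frac:
  assumes "finite J" "I \<subseteq> J" and m: "m \<in> carrier M" "k \<in> exponents I"
  shows "loc_map R N t J f (M.frac I m k) = N.frac J (f m) k"
proof -
  have "N.frac J (f n) l = N.frac J (f m) k" if "(n, l) \<in> M.frac I m k" for n l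
  proof -
    have nl: "n \<in> carrier M" "l \<in> exponents I" "M.frac I n l = M.frac I m k"
      using that m by (auto simp: M.mem_frac_iff)
    then obtain j where j: "j \<in> exponents I" "M.T I j (M.T I k n) = M.T I j (M.T I l m)"
      using m by (auto simp: M.frac_eq_iff)
    have "N.T I j (N.T I k (f n)) = N.T I j (N.T I l (f m))"
      using arg_cong[OF j(2), of f] nl m by (simp add: f_smult)
    then have "N.T J j (N.T J k (f n)) = N.T J j (N.T J l (f m))"
      using assms nl j by (simp add: M.tpow_mono)
    then show ?thesis
      using assms nl j exponents_mono[OF assms(2)] by (subst N.frac_eq_iff) auto
  qed
  note const = this
  have "(\<Union>a\<in>M.frac I m k. case a of (m, k) \<Rightarrow> N.frac J (f m) k)
      = (case (m, k) of (m, k) \<Rightarrow> N.frac J (f m) k)"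
  proof (rule UN_const_on)
    show "(m, k) \<in> M.frac I m k" using m by simp
    show "(case a of (m, k) \<Rightarrow> N.frac J (f m) k) = (case (m, k) of (m, k) \<Rightarrow> N.frac J (f m) k)"
      if "a \<in> M.frac I m k" for a
      using const that by (cases a) simp
  qed
  then show ?thesis by (simp add: loc_map_def)
qed

lemma loc_map_hom:
  assumes "finite J" "I \<subseteq> J"
  shows "loc_map R N t J f \<in> hom (add_monoid (M.loc I)) (add_monoid (N.loc J))"
proof (rule homI)
  have [simp]: "k \<in> exponents J" if "k \<in> exponents I" for k
    using exponents_mono[OF assms(2)] that by auto
  fix X assume "X \<in> carrier (add_monoid (M.loc I))"
  then obtain m k where X: "m \<in> carrier M" "k \<in> exponents I" "X = M.frac I m k"
    by (auto simp: M.loc_carrier)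
  then show "loc_map R N t J f X \<in> carrier (add_monoid (N.loc J))"
    by (simp add: loc_map_frac[OF assms])
  fix Y assume "Y \<in> carrier (add_monoid (M.loc I))"
  then obtain m' k' where Y: "m' \<in> carrier M" "k' \<in> exponents I" "Y = M.frac I m' k'"
    by (auto simp: M.loc_carrier)
  then show "loc_map R N t J f (X \<otimes>\<^bsub>add_monoid (M.loc I)\<^esub> Y)
      = loc_map R N t J f X \<otimes>\<^bsub>add_monoid (N.loc J)\<^esub> loc_map R N t J f Y"
    using X by (simp add: M.frac_add N.frac_add loc_map_frac[OF assms] f_add f_smult
        M.tpow_mono[OF assms])
qed

lemma loc_map_closed:
  "finite J \<Longrightarrow> I \<subseteq> J \<Longrightarrow> X \<in> carrier (M.loc I) \<Longrightarrow> loc_map R N t J f X \<in> carrier (N.loc J)"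
  using loc_map_hom by (auto simp: hom_def)

text \<open>Exactness of localization: f(m)/t^k = 0 means t^j f(m) = 0 for some j, so t^j m lies in
  the kernel of f, and m/t^k = t^j m/t^(j+k). For the projection to P/L the new numerator lies in
  L.\<close>

lemma loc_map_eq_zeroE:
  assumes "finite I" "X \<in> carrier (M.loc I)" "loc_map R N t I f X = \<zero>\<^bsub>N.loc I\<^esub>"
  obtains m k where "m \<in> carrier M" "k \<in> exponents I" "f m = \<zero>\<^bsub>N\<^esub>" "X = M.frac I m k"
proof -
  obtain m k where X: "m \<in> carrier M" "k \<in> exponents I" "X = M.frac I m k"
    using assms by (auto simp: M.loc_carrier)
  then obtain j where j: "j \<in> exponents I" "N.T I j (f m) = \<zero>\<^bsub>N\<^esub>"
    using assms by (auto simp: loc_map_frac N.loc_zero N.frac_eq_iff N.tpow_zero)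
  show ?thesis
  proof
    show "M.T I j m \<in> carrier M" "(\<lambda>i. j i + k i) \<in> exponents I" "f (M.T I j m) = \<zero>\<^bsub>N\<^esub>"
      using X j by (auto simp: f_smult)
    show "X = M.frac I (M.T I j m) (\<lambda>i. j i + k i)"
      unfolding X(3) using X j by (intro M.frac_eqI) (auto simp: M.T_simps)
  qed
qed

lemma loc_map_surj:
  assumes surj: "f ` carrier M = carrier N" and "finite I" "Y \<in> carrier (N.loc I)"
  shows "\<exists>X\<in>carrier (M.loc I). loc_map R N t I f X = Y"
proof -
  obtain m k where "m \<in> carrier M" "k \<in> exponents I" "Y = N.frac I (f m) k"
    using assms by (auto simp: N.loc_carrier surj[symmetric])
  then show ?thesis
    using assms by (intro bexI[of _ "M.frac I m k"]) (auto simp: loc_map_frac)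
qed

end

context localization
begin

lemma localization_hom_id: "localization_hom R M M t (\<lambda>m. m)"
  by unfold_locales auto

lemmas loc_map_id_frac = localization_hom.loc_map_frac[OF localization_hom_id]
lemmas loc_map_id_closed = localization_hom.loc_map_closed[OF localization_hom_id]

section \<open>Cech differentials\<close>

lemma cech_face_closed:
  assumes "I \<in> cech_index D (Suc q)" "i \<in> I" "\<And>K. K \<in> cech_index D q \<Longrightarrow> \<phi> K \<in> carrier (loc K)"
  shows "loc_map R M t I (\<lambda>m. m) (\<phi> (I - {i})) \<in> carrier (loc I)"
proof -
  have "finite I" "I - {i} \<in> cech_index D q"
    using assms finite_subset[of I] by (auto simp: cech_index_def)
  then show ?thesis
    using assms by (intro loc_map_id_closed[where I = "I - {i}"]) auto
qed

lemma cech_diff_closed: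
  assumes "I \<in> cech_index D (Suc q)" "\<And>K. K \<in> cech_index D q \<Longrightarrow> \<phi> K \<in> carrier (loc K)"
  shows "cech_diff R M t D q \<phi> I \<in> carrier (loc I)"
proof -
  interpret loc: abelian_group "loc I" by (rule abelian_group_loc)
  show ?thesis
    using assms cech_face_closed[OF assms(1) _ assms(2)] by (simp add: cech_diff_def)
qed

end

context localization_hom
begin

text \<open>Naturality of the Cech differential. It turns the cocycle condition over P/L into the
  statement that the coboundary of a lift maps to zero over P/L.\<close>

lemma loc_map_cech_diff:
  assumes I: "I \<in> cech_index D (Suc q)"
    and \<phi>': "\<And>K. K \<in> cech_index D q \<Longrightarrow> \<phi>' K \<in> carrier (M.loc K)"
    and \<phi>: "\<And>K. K \<in> cech_index D q \<Longrightarrow> loc_map R N t K f (\<phi>' K) = \<phi> K"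
  shows "loc_map R N t I f (cech_diff R M t D q \<phi>' I) = cech_diff R N t D q \<phi> I"
proof -
  have fin: "finite I" using I finite_subset[of I] by (auto simp: cech_index_def)
  interpret LM: abelian_group "M.loc I" by (rule M.abelian_group_loc)
  interpret LN: abelian_group "N.loc I" by (rule N.abelian_group_loc)
  \<comment> \<open>Both composites send m/t^k to f(m)/t^k.\<close>
  have face: "loc_map R N t I f (loc_map R M t I (\<lambda>m. m) (\<phi>' (I - {i})))
      = loc_map R N t I (\<lambda>m. m) (\<phi> (I - {i}))" if "i \<in> I" for i
  proof -
    have K: "I - {i} \<in> cech_index D q" "finite (I - {i})"
      using I that fin by (auto simp: cech_index_def)
    obtain m k where m: "m \<in> carrier M" "k \<in> exponents (I - {i})" "\<phi>' (I - {i}) = M.frac (I - {i}) m k"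
      using \<phi>'[OF K(1)] by (auto simp: M.loc_carrier)
    have "k \<in> exponents I" using m(2) exponents_mono[of "I - {i}" I] by auto
    moreover have "\<phi> (I - {i}) = N.frac (I - {i}) (f m) k"
      using \<phi>[OF K(1)] m K by (simp add: loc_map_frac)
    ultimately show ?thesis
      using m fin by (simp add: loc_map_frac M.loc_map_id_frac N.loc_map_id_frac Diff_subset)
  qed
  note hom = loc_map_hom[OF fin subset_refl]
  have closed: "loc_map R M t I (\<lambda>m. m) (\<phi>' (I - {i})) \<in> carrier (M.loc I)" if "i \<in> I" for i
    using M.cech_face_closed[OF I that \<phi>'] .
  have "loc_map R N t I f (cech_diff R M t D q \<phi>' I)
      = (\<Oplus>\<^bsub>N.loc I\<^esub>i\<in>I. loc_map R N t I f (add_pow (M.loc I) ((- 1 :: int) ^ card {j \<in> I. j < i})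
         (loc_map R M t I (\<lambda>m. m) (\<phi>' (I - {i})))))"
    using I closed
    by (simp add: cech_diff_def abelian_group_hom_finsum[OF LM.abelian_group_axioms LN.abelian_group_axioms hom])
  also have "\<dots> = cech_diff R N t D q \<phi> I"
    using I closed face loc_map_closed[OF fin subset_refl closed]
    by (simp add: cech_diff_def Pi_iff LN.finsum_cong'
      abelian_group_hom_int_pow[OF LM.abelian_group_axioms LN.abelian_group_axioms hom] cong: LN.finsum_cong')
  finally show ?thesis .
qed

end

section \<open>Products of formal sums supported in a cone\<close>

definition supported_in :: "('g \<Rightarrow> 'a::zero) \<Rightarrow> 'g set \<Rightarrow> bool" where
  "supported_in f C \<longleftrightarrow> {a. f a \<noteq> 0} \<subseteq> C"

definition add_closed :: "'g::ab_group_add set \<Rightarrow> bool" where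
  "add_closed C \<longleftrightarrow> 0 \<in> C \<and> (\<forall>a\<in>C. \<forall>b\<in>C. a + b \<in> C)"

text \<open>Only finitely many decompositions of each c inside \<open>C\<close>: this makes every
  coefficient of a convolution of formal sums supported in \<open>C\<close> a finite sum.\<close>

definition fin_cone :: "'g::ab_group_add set \<Rightarrow> bool" where
  "fin_cone C \<longleftrightarrow> add_closed C \<and> (\<forall>c. finite {a \<in> C. c - a \<in> C})"

text \<open>The defining sum runs over a set that depends on both factors; a common finite superset
  allows different products to be compared term by term.\<close>

lemma fs_mult_eq_sum:
  assumes "finite S" "\<And>a. f a \<noteq> 0 \<Longrightarrow> g (c - a) \<noteq> 0 \<Longrightarrow> a \<in> S"
  shows "fs_mult f g c = (\<Sum>a\<in>S. f a * g (c - a))"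
  unfolding fs_mult_def using assms by (intro sum.mono_neutral_left) auto

lemma fs_one_eq: "fs_one a = (if a = 0 then of_int_mod_ring 1 else 0)"
  by (auto simp: fs_one_def xpow_def lookup_single when_def)

lemma fs_mult_one_left [simp]: "fs_mult fs_one g = g"
proof
  fix c
  show "fs_mult fs_one g c = g c"
    by (subst fs_mult_eq_sum[of "{0}"]) (auto simp: fs_one_eq split: if_splits)
qed

lemma supported_in_fs_one: "add_closed C \<Longrightarrow> supported_in fs_one C"
  by (auto simp: supported_in_def fs_one_eq add_closed_def split: if_splits)

lemma supported_in_fs_mult:
  assumes "add_closed C" "supported_in f C" "supported_in g C"
  shows "supported_in (fs_mult f g) C"
proof -
  have "c \<in> C" if nz: "fs_mult f g c \<noteq> 0" for c
  proof -
    obtain a where "f a \<noteq> 0" "g (c - a) \<noteq> 0"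
      using nz unfolding fs_mult_def by (smt (verit) Collect_empty_eq sum.empty)
    then have "a \<in> C" "c - a \<in> C" using assms by (auto simp: supported_in_def)
    then have "a + (c - a) \<in> C" using assms(1) unfolding add_closed_def by blast
    then show ?thesis by simp
  qed
  then show ?thesis by (auto simp: supported_in_def)
qed

text \<open>Both identities are associativity with one factor t = 1 - x^g, valid because all
  coefficient sums are finite. The element g may lie outside \<open>C\<close>, so t f and t h can
  leave the cone and their ranges of summation must be enlarged by hand.\<close>

lemma fs_mult_shift:
  fixes f h :: "'g::ab_group_add \<Rightarrow> 'n::finite mod_ring"
  assumes "fin_cone C" "supported_in f C" "supported_in h C"
  shows fs_smult_fs_mult_left: "fs_smult (*) (xpow 0 - xpow g) (fs_mult f h)
      = fs_mult (fs_smult (*) (xpow 0 - xpow g) f) h"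
    and fs_smult_fs_mult_right: "fs_smult (*) (xpow 0 - xpow g) (fs_mult f h)
      = fs_mult f (fs_smult (*) (xpow 0 - xpow g) h)"
proof -
  define S where "S c = {a \<in> C. c - a \<in> C}" for c
  have fin: "finite (S c)" for c using assms by (simp add: S_def fin_cone_def)
  have C: "a \<in> C" if "f a \<noteq> 0 \<or> h a \<noteq> 0" for a
    using assms that by (auto simp: supported_in_def)
  have fh: "fs_mult f h c = (\<Sum>a\<in>S'. f a * h (c - a))" if "finite S'" "S c \<subseteq> S'" for c S'
    using that C by (intro fs_mult_eq_sum) (auto simp: S_def)
  show "fs_smult (*) (xpow 0 - xpow g) (fs_mult f h)
      = fs_mult f (fs_smult (*) (xpow 0 - xpow g) h)"
  proof
    fix c
    \<comment> \<open>The coefficient of f (t h) at c involves h at c - a and at c - g - a, hence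
      the decompositions of both c and c - g.\<close>
    let ?S = "S c \<union> S (c - g)"
    have "fs_mult f (fs_smult (*) (xpow 0 - xpow g) h) c
        = (\<Sum>a\<in>?S. f a * (h (c - a) - h (c - a - g)))"
    proof (subst fs_mult_eq_sum[of ?S])
      fix a assume a: "f a \<noteq> 0" "fs_smult (*) (xpow 0 - xpow g) h (c - a) \<noteq> 0"
      have "c - g - a = c - a - g" by (simp add: algebra_simps)
      with a(2) have "h (c - a) \<noteq> 0 \<or> h (c - g - a) \<noteq> 0"
        unfolding fs_smult_one_minus_xpow by (metis diff_self)
      then consider "h (c - a) \<noteq> 0" | "h (c - g - a) \<noteq> 0" by blast
      then show "a \<in> ?S" using C a by cases (simp_all add: S_def)
    qed (use fin in \<open>auto simp: fs_smult_one_minus_xpow\<close>)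
    also have "\<dots> = fs_mult f h c - fs_mult f h (c - g)"
      using fin by (simp add: fh[of ?S] right_diff_distrib sum_subtractf algebra_simps)
    finally show "fs_smult (*) (xpow 0 - xpow g) (fs_mult f h) c
        = fs_mult f (fs_smult (*) (xpow 0 - xpow g) h) c"
      by (simp add: fs_smult_one_minus_xpow)
  qed
  show "fs_smult (*) (xpow 0 - xpow g) (fs_mult f h)
      = fs_mult (fs_smult (*) (xpow 0 - xpow g) f) h"
  proof
    fix c
    \<comment> \<open>The shifted term is now f at a - g, so the decompositions of c - g enter
      translated by g; the reindexing below undoes the translation.\<close>
    let ?S = "S c \<union> (\<lambda>a. a + g) ` S (c - g)"
    have "fs_mult (fs_smult (*) (xpow 0 - xpow g) f) h c
        = (\<Sum>a\<in>?S. (f a - f (a - g)) * h (c - a))"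
    proof (subst fs_mult_eq_sum[of ?S])
      fix a assume a: "fs_smult (*) (xpow 0 - xpow g) f a \<noteq> 0" "h (c - a) \<noteq> 0"
      then have "f a \<noteq> 0 \<or> f (a - g) \<noteq> 0"
        unfolding fs_smult_one_minus_xpow by (metis diff_self)
      then consider "f a \<noteq> 0" | "f (a - g) \<noteq> 0" by blast
      then show "a \<in> ?S"
      proof cases
        case 2
        then have "a - g \<in> S (c - g)" using C a by (simp add: S_def)
        then show ?thesis by (auto intro!: image_eqI[of _ _ "a - g"])
      qed (use C a in \<open>simp add: S_def\<close>)
    qed (use fin in \<open>auto simp: fs_smult_one_minus_xpow\<close>)
    also have "\<dots> = fs_mult f h c - (\<Sum>a\<in>?S. f (a - g) * h (c - a))"
      using fin by (simp add: fh[of ?S] left_diff_distrib sum_subtractf)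
    also have "(\<Sum>a\<in>?S. f (a - g) * h (c - a)) = (\<Sum>a\<in>(\<lambda>a. a - g) ` ?S. f a * h (c - g - a))"
      by (subst sum.reindex) (auto simp: inj_on_def algebra_simps)
    also have "\<dots> = fs_mult f h (c - g)"
      using fin by (intro fh[symmetric]) (auto simp: image_Un image_image)
    finally show "fs_smult (*) (xpow 0 - xpow g) (fs_mult f h) c
        = fs_mult (fs_smult (*) (xpow 0 - xpow g) f) h c"
      unfolding fs_smult_one_minus_xpow[of g "fs_mult f h"] by (rule sym)
  qed
qed

section \<open>Geometric series\<close>

lemma zscale_zero [simp]: "zscale 0 g = 0"
  by (simp add: zscale_def)

lemma zscale_one [simp]: "zscale 1 g = g"
  by (simp add: zscale_def)

lemma geom_eq_zero:
  assumes "a \<notin> range (\<lambda>k. zscale k g)"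
  shows "geom g e a = 0"
proof -
  have "zscale k g \<noteq> a" for k using assms by auto
  then show ?thesis by (simp add: geom_def del: zmod.scale_minus_left)
qed

text \<open>Infinite order leaves at most one j in each defining sum. Position 0 belongs to the
  positive expansion only, as the negative one starts at j = 1.\<close>

lemma geom_zscale:
  fixes g :: "'g::ab_group_add"
  assumes inf: "\<And>k. zscale k g = 0 \<Longrightarrow> k = 0"
  shows "(geom g e (zscale k g) :: 'n::finite mod_ring) =
    (if e = 1 then if k \<ge> 0 then of_int_mod_ring 1 else 0
     else if k < 0 then - of_int_mod_ring 1 else 0)"
proof -
  have eq: "zscale k g = zscale l g \<longleftrightarrow> k = l" for k l
  proof -
    have "zscale k g - zscale l g = zscale (k - l) g"
      using zscale_add_left[of k "- l" g] by (simp add: zscale_uminus)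
    then show ?thesis using inf[of "k - l"] by auto
  qed
  have "{j. zscale (int j) g = zscale k g} = (if k \<ge> 0 then {nat k} else {})"
    "{j. j \<ge> 1 \<and> zscale (- int j) g = zscale k g} = (if k < 0 then {nat (- k)} else {})"
    by (auto simp: eq simp del: zmod.scale_minus_left)
  then show ?thesis by (simp add: geom_def del: zmod.scale_minus_left)
qed

text \<open>Along the multiples of g both expansions step up by one from position -1 to position 0
  and are constant elsewhere, so the difference operator t sends each of them to
  \<open>fs_one\<close>.\<close>

lemma fs_smult_geom:
  fixes g :: "'g::ab_group_add"
  assumes inf: "\<And>k. zscale k g = 0 \<Longrightarrow> k = 0"
  shows "fs_smult (*) (xpow 0 - xpow g) (geom g e) = (fs_one :: 'g \<Rightarrow> 'n::finite mod_ring)"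
proof
  fix a
  show "fs_smult (*) (xpow 0 - xpow g) (geom g e) a = (fs_one a :: 'n mod_ring)"
  proof (cases "a \<in> range (\<lambda>k. zscale k g)")
    case True
    then obtain k where a: "a = zscale k g" by auto
    have "a - g = zscale (k - 1) g"
      using zscale_add_left[of "k - 1" 1 g] by (simp add: a algebra_simps)
    moreover have "a = 0 \<longleftrightarrow> k = 0" using inf a by auto
    ultimately show ?thesis
      by (auto simp: fs_smult_one_minus_xpow geom_zscale[OF inf] a fs_one_eq)
  next
    case False
    have "a - g \<notin> range (\<lambda>k. zscale k g)"
    proof
      assume "a - g \<in> range (\<lambda>k. zscale k g)"
      then obtain k where "a - g = zscale k g" by auto
      then have "a = zscale (k + 1) g" by (simp add: zscale_add_left algebra_simps)
      then show False using False by auto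
    qed
    moreover have "a \<noteq> 0" using False zscale_zero[of g] by (metis rangeI)
    ultimately show ?thesis
      using False by (simp add: fs_smult_one_minus_xpow geom_eq_zero fs_one_eq)
  qed
qed

section \<open>Powers and products of geometric series\<close>

definition geom_pow :: "'g \<Rightarrow> int \<Rightarrow> nat \<Rightarrow> 'g::ab_group_add \<Rightarrow> 'n::finite mod_ring" where
  "geom_pow g e m = (fs_mult (geom g e) ^^ m) fs_one"

lemma inv_tpow_eq:
  "inv_tpow \<gamma> I e k = foldr (\<lambda>i. fs_mult (geom_pow (\<gamma> i) (e i) (k i))) (sorted_list_of_set I) fs_one"
  by (simp add: inv_tpow_def geom_pow_def)

lemma supported_in_geom_pow:
  "add_closed C \<Longrightarrow> supported_in (geom g e :: 'g::ab_group_add \<Rightarrow> 'n::finite mod_ring) C \<Longrightarrow>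
    supported_in (geom_pow g e m :: 'g \<Rightarrow> 'n mod_ring) C"
  by (induction m) (simp_all add: geom_pow_def supported_in_fs_one supported_in_fs_mult)

lemma supported_in_foldr_geom_pow:
  "add_closed C \<Longrightarrow>
    (\<And>i. i \<in> set xs \<Longrightarrow> supported_in (geom (\<gamma> i) (e i) :: 'g::ab_group_add \<Rightarrow> 'n::finite mod_ring) C) \<Longrightarrow>
    supported_in (foldr (\<lambda>i. fs_mult (geom_pow (\<gamma> i) (e i) (k i))) xs fs_one :: 'g \<Rightarrow> 'n mod_ring) C"
  by (induction xs) (simp_all add: supported_in_fs_one supported_in_fs_mult supported_in_geom_pow)

lemma fs_smult_geom_pow:
  fixes g :: "'g::ab_group_add"
  assumes "\<And>k. zscale k g = 0 \<Longrightarrow> k = 0" "fin_cone C"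
    and "supported_in (geom g e :: 'g \<Rightarrow> 'n::finite mod_ring) C"
  shows "fs_smult (*) (xpow 0 - xpow g) (geom_pow g e (Suc m)) = (geom_pow g e m :: 'g \<Rightarrow> 'n mod_ring)"
proof -
  have "fs_smult (*) (xpow 0 - xpow g) (fs_mult (geom g e) (geom_pow g e m) :: 'g \<Rightarrow> 'n mod_ring)
      = fs_mult (fs_smult (*) (xpow 0 - xpow g) (geom g e)) (geom_pow g e m)"
    using assms supported_in_geom_pow
    by (intro fs_smult_fs_mult_left[of C]) (auto simp: fin_cone_def)
  then show ?thesis by (simp add: fs_smult_geom[OF assms(1)] geom_pow_def)
qed

text \<open>The factor t_j passes the series with other indices until it meets the one with index j,
  where it lowers the exponent. Distinctness of the list makes the raised exponent occur in just one
  factor.\<close>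

lemma fs_smult_foldr_geom_pow:
  fixes \<gamma> :: "nat \<Rightarrow> 'g::ab_group_add"
  assumes inf: "\<And>k. zscale k (\<gamma> j) = 0 \<Longrightarrow> k = 0" and C: "fin_cone C"
  shows "distinct xs \<Longrightarrow> j \<in> set xs \<Longrightarrow> 
    (\<And>i. i \<in> set xs \<Longrightarrow> supported_in (geom (\<gamma> i) (e i) :: 'g \<Rightarrow> 'n::finite mod_ring) C) \<Longrightarrow>
    fs_smult (*) (xpow 0 - xpow (\<gamma> j))
      (foldr (\<lambda>i. fs_mult (geom_pow (\<gamma> i) (e i) ((k(j := Suc (k j))) i))) xs fs_one)
    = (foldr (\<lambda>i. fs_mult (geom_pow (\<gamma> i) (e i) (k i))) xs fs_one :: 'g \<Rightarrow> 'n mod_ring)"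
proof (induction xs)
  case (Cons i xs)
  let ?F = "\<lambda>k. foldr (\<lambda>i. fs_mult (geom_pow (\<gamma> i) (e i) (k i))) xs fs_one :: 'g \<Rightarrow> 'n mod_ring"
  let ?k = "k(j := Suc (k j))"
  have add: "add_closed C" using C by (simp add: fin_cone_def)
  have supp: "supported_in (?F k) C" "supported_in (geom_pow (\<gamma> i) (e i) m :: 'g \<Rightarrow> 'n mod_ring) C" for k m
    using Cons.prems add by (auto intro: supported_in_foldr_geom_pow supported_in_geom_pow)
  show ?case
  proof (cases "i = j")
    case True
    have "?F ?k = ?F k" using Cons.prems True by (intro foldr_cong) auto
    then show ?thesis
      using True supp Cons.prems inf C
      by (simp add: fs_smult_fs_mult_left[OF C] fs_smult_geom_pow[of "\<gamma> j" C])
  next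
    case False
    then show ?thesis
      using supp Cons.prems Cons.IH by (simp add: fs_smult_fs_mult_right[OF C])
  qed
qed simp

section \<open>Orthants of an independent family\<close>

locale free_family =
  fixes \<gamma> :: "nat \<Rightarrow> 'g::ab_group_add" and B :: "nat set"
  assumes finite_B: "finite B"
    and inj_\<gamma>: "inj_on \<gamma> B"
    and independent_\<gamma>: "\<not> zmod.dependent (\<gamma> ` B)"
begin

text \<open>Independence is a property of the set of vectors; injectivity lets a family of
  coefficients be read as a function on that set.\<close>

lemma sum_zscale_eq_zero:
  assumes "(\<Sum>i\<in>B. zscale (u i) (\<gamma> i)) = 0" "i \<in> B"
  shows "u i = 0"
proof -
  define v where "v a = u (the_inv_into B \<gamma> a)" for a
  have v: "v (\<gamma> i) = u i" if "i \<in> B" for i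
    using that inj_\<gamma> by (simp add: v_def the_inv_into_f_f)
  have "(\<Sum>a\<in>\<gamma> ` B. zscale (v a) a) = 0"
    using assms(1) by (simp add: sum.reindex[OF inj_\<gamma>] v)
  then have "zmod.dependent (\<gamma> ` B)" if "u i \<noteq> 0"
    using that finite_B assms(2) v
    by (subst zmod.dependent_finite) (auto intro!: exI[of _ v] bexI[of _ i])
  then show ?thesis using independent_\<gamma> by blast
qed

lemma sum_zscale_eq:
  assumes "(\<Sum>i\<in>B. zscale (u i) (\<gamma> i)) = (\<Sum>i\<in>B. zscale (v i) (\<gamma> i))" "i \<in> B"
  shows "u i = v i"
proof -
  have "(\<Sum>i\<in>B. zscale (u i - v i) (\<gamma> i)) = 0"
    using assms(1) by (simp add: zmod.scale_left_diff_distrib sum_subtractf)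
  then show ?thesis using sum_zscale_eq_zero[of "\<lambda>i. u i - v i"] assms(2) by simp
qed

lemma sum_zscale_single: "i \<in> B \<Longrightarrow> (\<Sum>j\<in>B. zscale (if j = i then k else 0) (\<gamma> j)) = zscale k (\<gamma> i)"
  using finite_B by (simp add: if_distrib[of "\<lambda>k. zscale k _"] sum.delta' cong: if_cong)

lemma infinite_order: "i \<in> B \<Longrightarrow> zscale k (\<gamma> i) = 0 \<Longrightarrow> k = 0"
  using sum_zscale_eq_zero[of "\<lambda>j. if j = i then k else 0" i] by (simp add: sum_zscale_single)

text \<open>The cone spanned by the vectors e_i \<gamma>_i. As in \<open>geom\<close>, every value
  of \<open>e\<close> other than 1 is read as the sign -1.\<close>

definition orthant :: "(nat \<Rightarrow> int) \<Rightarrow> 'g set" where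
  "orthant e = range (\<lambda>n. \<Sum>i\<in>B. zscale ((if e i = 1 then 1 else - 1) * int (n i)) (\<gamma> i))"

text \<open>Coordinates are unique, so decomposing the point with coordinates n means splitting n =
  m + m' coordinatewise, and m lies in the finite box below n.\<close>

lemma fin_cone_orthant: "fin_cone (orthant e)"
proof -
  define pt where "pt n = (\<Sum>i\<in>B. zscale ((if e i = 1 then 1 else - 1) * int (n i)) (\<gamma> i))" for n
  have C: "orthant e = range pt" by (simp add: orthant_def pt_def[abs_def])
  have pt_add: "pt n + pt m = pt (\<lambda>i. n i + m i)" for n m
    by (simp add: pt_def zscale_add_left[symmetric] distrib_left sum.distrib[symmetric])
  have pt_inj: "n i = m i" if "pt n = pt m" "i \<in> B" for n m i
    using sum_zscale_eq[OF that[unfolded pt_def]] by (simp split: if_splits)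
  have "finite {a \<in> orthant e. c - a \<in> orthant e}" for c
  proof (cases "c \<in> orthant e")
    case True
    then obtain n where n: "c = pt n" by (auto simp: C)
    have "{a \<in> orthant e. c - a \<in> orthant e} \<subseteq> pt ` (\<Pi>\<^sub>E i\<in>B. {..n i})"
    proof safe
      fix a assume "a \<in> orthant e" "c - a \<in> orthant e"
      then obtain m m' where m: "a = pt m" "c - a = pt m'" by (auto simp: C)
      then have "pt n = pt (\<lambda>i. m i + m' i)" using n by (simp add: pt_add[symmetric] algebra_simps)
      then have "n i = m i + m' i" if "i \<in> B" for i using pt_inj that by blast
      \<comment> \<open>Only the coordinates in \<open>B\<close> count; restriction to
        \<open>B\<close> moves m into a finite set of extensional functions without changing the
        point.\<close>
      then have "restrict m B \<in> (\<Pi>\<^sub>E i\<in>B. {..n i})" by auto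
      moreover have "a = pt (restrict m B)" by (simp add: m pt_def)
      ultimately show "a \<in> pt ` (\<Pi>\<^sub>E i\<in>B. {..n i})" by blast
    qed
    then show ?thesis
      by (rule finite_subset) (auto intro!: finite_imageI finite_PiE finite_B)
  next
    case False
    have "a + (c - a) \<in> orthant e" if ac: "a \<in> orthant e" "c - a \<in> orthant e" for a
    proof -
      obtain m m' where "a = pt m" "c - a = pt m'" using ac by (auto simp: C)
      then have "a + (c - a) = pt (\<lambda>i. m i + m' i)" by (simp only: pt_add)
      then show ?thesis unfolding C by blast
    qed
    then have "{a \<in> orthant e. c - a \<in> orthant e} = {}" using False by auto
    then show ?thesis by (simp only: finite.emptyI)
  qed
  moreover have "a + b \<in> orthant e" if "a \<in> orthant e" "b \<in> orthant e" for a b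
    using that pt_add by (auto simp: C)
  moreover have "pt (\<lambda>i. 0) = 0" by (simp add: pt_def)
  then have "0 \<in> orthant e" unfolding C by (metis rangeI)
  ultimately show ?thesis by (simp add: fin_cone_def add_closed_def)
qed

lemma supported_in_geom:
  assumes i: "i \<in> B"
  shows "supported_in (geom (\<gamma> i) (e i) :: 'g \<Rightarrow> 'n::finite mod_ring) (orthant e)"
proof -
  have "a \<in> orthant e" if nz: "geom (\<gamma> i) (e i) a \<noteq> (0 :: 'n mod_ring)" for a
  proof -
    have "a \<in> range (\<lambda>k. zscale k (\<gamma> i))" using nz by (metis geom_eq_zero)
    then obtain k where a: "a = zscale k (\<gamma> i)" by auto
    \<comment> \<open>The element has a single coordinate k, in direction i; the support of the
      chosen expansion forces its sign to agree with \<open>e i\<close>.\<close>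
    define n where "n j = (if j = i then nat \<bar>k\<bar> else 0)" for j
    have "if e i = 1 then k \<ge> 0 else k < 0"
      using nz infinite_order[OF i] by (auto simp: a geom_zscale split: if_splits)
    then have "k = (if e i = 1 then 1 else - 1) * int (nat \<bar>k\<bar>)"
      by (auto split: if_splits)
    then have "(if e j = 1 then 1 else - 1) * int (n j) = (if j = i then k else 0)" for j
      by (auto simp: n_def)
    then have "a = (\<Sum>j\<in>B. zscale ((if e j = 1 then 1 else - 1) * int (n j)) (\<gamma> j))"
      by (simp add: a sum_zscale_single[OF i])
    then show ?thesis by (auto simp: orthant_def)
  qed
  then show ?thesis by (auto simp: supported_in_def)
qed

lemma fs_smult_inv_tpow:
  assumes "I \<subseteq> B" "j \<in> I"
  shows "fs_smult (*) (xpow 0 - xpow (\<gamma> j)) (inv_tpow \<gamma> I e (k(j := Suc (k j)))) = inv_tpow \<gamma> I e k"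
proof -
  have fin: "finite I" using assms finite_B finite_subset by blast
  show ?thesis
    unfolding inv_tpow_eq using assms fin infinite_order
    by (intro fs_smult_foldr_geom_pow[where C = "orthant e"])
      (auto simp: fin_cone_orthant intro: supported_in_geom)
qed

end

text \<open>Signs matter only at nonzero exponents, because the zeroth power of either expansion is
  \<open>fs_one\<close>.\<close>

lemma inv_tpow_cong:
  assumes "\<And>i. i \<in> I \<Longrightarrow> k i = k' i" "\<And>i. i \<in> I \<Longrightarrow> k i \<noteq> 0 \<Longrightarrow> e i = e' i"
  shows "inv_tpow \<gamma> I e k = inv_tpow \<gamma> I e' k'"
proof (cases "finite I")
  case True
  have "geom_pow (\<gamma> i) (e i) (k i) = (geom_pow (\<gamma> i) (e' i) (k' i) :: _ \<Rightarrow> 'b mod_ring)" if "i \<in> I" for i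
    using assms[OF that] by (cases "k i = 0") (simp_all add: geom_pow_def)
  then show ?thesis unfolding inv_tpow_eq using True by (intro foldr_cong) auto
qed (simp add: inv_tpow_eq)

text \<open>The additional indices carry exponent zero and their factors act as the identity. Hence
  the signs outside \<open>I\<close> have no influence on the expansion over
  \<open>J\<close>.\<close>

lemma inv_tpow_subset:
  assumes "finite J" "I \<subseteq> J" "k \<in> exponents I"
  shows "inv_tpow \<gamma> J e k = inv_tpow \<gamma> I e k"
proof -
  have fin: "finite I" using assms finite_subset by blast
  have I: "sorted_list_of_set I = filter (\<lambda>i. i \<in> I) (sorted_list_of_set J)"
    using assms fin by (intro sorted_distinct_set_unique) (auto simp: sorted_wrt_filter)
  have "(if i \<in> I then fs_mult (geom_pow (\<gamma> i) (e i) (k i)) else id)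
      = (fs_mult (geom_pow (\<gamma> i) (e i) (k i)) :: (_ \<Rightarrow> 'b mod_ring) \<Rightarrow> _)" for i
    using assms(3) by (auto simp: exponents_def geom_pow_def)
  then show ?thesis by (simp add: inv_tpow_eq I foldr_filter)
qed

text \<open>The span is closed under addition and contains the support of each geometric series,
  hence that of their product. This bounds the directions in which an expanded fraction
  extends.\<close>

lemma inv_tpow_eq_zero:
  assumes "a \<notin> zmod.span (\<gamma> ` I)" "finite I"
  shows "inv_tpow \<gamma> I e k a = 0"
proof -
  let ?C = "zmod.span (\<gamma> ` I)"
  have "add_closed ?C"
    by (simp add: add_closed_def zmod.span_zero zmod.span_add)
  moreover have "supported_in (geom (\<gamma> i) (e i) :: _ \<Rightarrow> 'b mod_ring) ?C" if "i \<in> I" for i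
  proof -
    have "range (\<lambda>k. zscale k (\<gamma> i)) \<subseteq> ?C"
      using that by (auto intro: zmod.span_scale zmod.span_base)
    then show ?thesis using geom_eq_zero unfolding supported_in_def by blast
  qed
  ultimately have "supported_in (inv_tpow \<gamma> I e k :: _ \<Rightarrow> 'b mod_ring) ?C"
    unfolding inv_tpow_eq using assms by (intro supported_in_foldr_geom_pow) auto
  then show ?thesis using assms by (auto simp: supported_in_def)
qed

section \<open>Expansion of fractions\<close>

text \<open>Flipping the sign at \<open>j\<close> pairs the terms: \<open>F\<close> takes the same
  value on both and the product of the signs is negated.\<close>

lemma sum_signs_eq_zero:
  fixes F :: "(nat \<Rightarrow> int) \<Rightarrow> 'a::ab_group_add"
  assumes "finite I" "j \<in> I" and F: "\<And>e. F (e(j := 1)) = F (e(j := - 1))"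
  shows "(\<Sum>e\<in>I \<rightarrow>\<^sub>E {1, - 1}. zscale (\<Prod>i\<in>I. e i) (F e)) = 0"
proof -
  let ?I = "I - {j}"
  have I: "I = insert j ?I" "j \<notin> ?I" "finite ?I" using assms by auto
  have prod: "(\<Prod>i\<in>I. (e(j := y)) i) = y * (\<Prod>i\<in>?I. e i)" for e :: "nat \<Rightarrow> int" and y
    using assms by (subst I(1), subst prod.insert) (auto intro!: prod.cong)
  have "(\<Sum>e\<in>I \<rightarrow>\<^sub>E {1, - 1}. zscale (\<Prod>i\<in>I. e i) (F e))
      = (\<Sum>(y, e)\<in>{1, - 1} \<times> (?I \<rightarrow>\<^sub>E {1, - 1}). zscale (\<Prod>i\<in>I. (e(j := y)) i) (F (e(j := y))))"
    unfolding I(1)[THEN arg_cong[where f = "\<lambda>I. I \<rightarrow>\<^sub>E {1, - 1}"]] PiE_insert_eq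
    by (subst sum.reindex[OF inj_combinator[OF I(2)]]) (simp add: case_prod_beta)
  also have "\<dots> = (\<Sum>y\<in>{1, - 1}. \<Sum>e\<in>?I \<rightarrow>\<^sub>E {1, - 1}. zscale (y * (\<Prod>i\<in>?I. e i)) (F (e(j := y))))"
    by (simp only: sum.cartesian_product prod)
  also have "\<dots> = 0"
    by (simp add: zscale_uminus sum_negf F)
  finally show ?thesis .
qed

locale expansion = scalar_action s + free_family \<gamma> B
  for s :: "'n::finite mod_ring \<Rightarrow> 'p \<Rightarrow> 'p::ab_group_add"
    and \<gamma> :: "nat \<Rightarrow> 'g::ab_group_add" and B
begin

definition t :: "nat \<Rightarrow> 'g \<Rightarrow>\<^sub>0 'n mod_ring" where
  "t j = xpow 0 - xpow (\<gamma> j)"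

abbreviation P :: "('g \<Rightarrow>\<^sub>0 'n mod_ring, 'g \<Rightarrow>\<^sub>0 'p) module" where "P \<equiv> pauli_module s"

sublocale localization group_ring P t
  by (intro localization.intro localization_axioms.intro module_pauli_module) simp

lemma fs_smult_t_pow:
  assumes "I \<subseteq> B" "j \<in> I"
  shows "fs_smult (*) (t j [^]\<^bsub>group_ring\<^esub> m) (inv_tpow \<gamma> I e (k(j := k j + m))) = inv_tpow \<gamma> I e k"
proof (induction m)
  case 0
  show ?case by (simp add: fs_smult_xpow fun_eq_iff)
next
  case (Suc m)
  have "fs_smult (*) (t j) (inv_tpow \<gamma> I e (k(j := Suc (k j + m)))) = inv_tpow \<gamma> I e (k(j := k j + m))"
    using fs_smult_inv_tpow[OF assms, of e "k(j := k j + m)"] by (simp add: t_def)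
  then have "fs_smult (*) (t j [^]\<^bsub>group_ring\<^esub> Suc m) (inv_tpow \<gamma> I e (k(j := k j + Suc m)))
      = fs_smult (*) (t j [^]\<^bsub>group_ring\<^esub> m) (inv_tpow \<gamma> I e (k(j := k j + m)))"
    by (simp only: R.nat_pow_Suc group_ring_simps fs_smult_mult add_Suc_right)
  then show ?case using Suc by (simp only:)
qed

lemma fs_smult_tpow:
  assumes "I \<subseteq> B"
  shows "fs_smult (*) (tpow group_ring t I k') (inv_tpow \<gamma> I e (\<lambda>i. k i + k' i)) = inv_tpow \<gamma> I e k"
proof -
  have "finite I" using assms finite_B finite_subset by blast
  \<comment> \<open>Induction over the part \<open>A\<close> of \<open>I\<close> on which the
    exponents are raised; the claim is the case A = I.\<close>
  have "fs_smult (*) (\<Otimes>\<^bsub>group_ring\<^esub>i\<in>A. t i [^]\<^bsub>group_ring\<^esub> k' i)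
      (inv_tpow \<gamma> I e (\<lambda>i. if i \<in> A then k i + k' i else k i)) = inv_tpow \<gamma> I e k" if "A \<subseteq> I" for A
    using finite_subset[OF that \<open>finite I\<close>] that
  proof (induction A)
    case empty
    then show ?case by (simp add: fs_smult_xpow fun_eq_iff)
  next
    case (insert j A)
    let ?k = "\<lambda>i. if i \<in> A then k i + k' i else k i"
    have k: "(\<lambda>i. if i \<in> insert j A then k i + k' i else k i) = ?k(j := ?k j + k' j)"
      using insert.hyps by auto
    have "(\<Otimes>\<^bsub>group_ring\<^esub>i\<in>insert j A. t i [^]\<^bsub>group_ring\<^esub> k' i)
        = (\<Otimes>\<^bsub>group_ring\<^esub>i\<in>A. t i [^]\<^bsub>group_ring\<^esub> k' i) * t j [^]\<^bsub>group_ring\<^esub> k' j"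
      using insert.hyps by (simp add: mult.commute)
    then show ?case
      using insert fs_smult_t_pow[OF assms, of j "k' j" e ?k] unfolding k by (simp add: fs_smult_mult)
  qed
  note step = this[OF subset_refl]
  have eq: "inv_tpow \<gamma> I e (\<lambda>i. if i \<in> I then k i + k' i else k i)
      = (inv_tpow \<gamma> I e (\<lambda>i. k i + k' i) :: 'g \<Rightarrow> 'n mod_ring)"
    by (rule inv_tpow_cong) auto
  show ?thesis using step unfolding eq tpow_def .
qed

lemma fs_smult_T: "I \<subseteq> B \<Longrightarrow>
    fs_smult s (T I k' m) (inv_tpow \<gamma> I e (\<lambda>i. k i + k' i)) = fs_smult s m (inv_tpow \<gamma> I e k)"
  by (simp add: fs_smult_pauli_smult fs_smult_tpow)

lemma frac_expand_frac:
  assumes "I \<subseteq> B" "k \<in> exponents I"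
  shows "frac_expand s \<gamma> I e (frac I m k) = fs_smult s m (inv_tpow \<gamma> I e k)"
proof -
  have "fs_smult s m' (inv_tpow \<gamma> I e k') = fs_smult s m (inv_tpow \<gamma> I e k)"
    if mk: "(m', k') \<in> frac I m k" for m' k'
  proof -
    have k': "k' \<in> exponents I" using mk assms by (auto simp: mem_frac_iff)
    then obtain j where j: "j \<in> exponents I" "T I j (T I k m') = T I j (T I k' m)"
      using mk assms by (auto simp: mem_frac_iff frac_eq_iff)
    \<comment> \<open>Both fractions are brought to the common exponent j + k + k', where the
      witness j makes the numerators equal.\<close>
    have "fs_smult s m' (inv_tpow \<gamma> I e k')
        = fs_smult s (T I (\<lambda>i. j i + k i) m') (inv_tpow \<gamma> I e (\<lambda>i. k' i + (j i + k i)))"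
      by (rule fs_smult_T[OF assms(1), symmetric])
    also have "T I (\<lambda>i. j i + k i) m' = T I (\<lambda>i. j i + k' i) m"
      using j by (simp add: T_add[simplified])
    also have "(\<lambda>i. k' i + (j i + k i)) = (\<lambda>i. k i + (j i + k' i))"
      by (simp add: add_ac)
    also have "fs_smult s (T I (\<lambda>i. j i + k' i) m) (inv_tpow \<gamma> I e \<dots>) = fs_smult s m (inv_tpow \<gamma> I e k)"
      by (rule fs_smult_T[OF assms(1)])
    finally show ?thesis .
  qed
  note const = this
  have "(\<lambda>(m, k). fs_smult s m (inv_tpow \<gamma> I e k)) ` frac I m k
      = (\<lambda>_. fs_smult s m (inv_tpow \<gamma> I e k)) ` frac I m k"
  proof (rule image_cong[OF refl])
    show "(case x of (m, k) \<Rightarrow> fs_smult s m (inv_tpow \<gamma> I e k)) = fs_smult s m (inv_tpow \<gamma> I e k)"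
      if "x \<in> frac I m k" for x
      using const that by (cases x) simp
  qed
  also have "\<dots> = {fs_smult s m (inv_tpow \<gamma> I e k)}"
    using assms by (intro image_constant[of "(m, k)"]) simp
  finally have "(\<lambda>(m, k). fs_smult s m (inv_tpow \<gamma> I e k)) ` frac I m k
      = {fs_smult s m (inv_tpow \<gamma> I e k)}" .
  then show ?thesis by (simp add: frac_expand_def)
qed

lemma frac_expand_add:
  assumes "I \<subseteq> B" "X \<in> carrier (loc I)" "Y \<in> carrier (loc I)"
  shows "frac_expand s \<gamma> I e (X \<oplus>\<^bsub>loc I\<^esub> Y) a = frac_expand s \<gamma> I e X a + frac_expand s \<gamma> I e Y a"
proof -
  obtain m k m' k' where X: "k \<in> exponents I" "X = frac I m k" and Y: "k' \<in> exponents I" "Y = frac I m' k'"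
    using assms(2,3) by (auto simp: loc_carrier)
  \<comment> \<open>In the second summand the exponent is written as k' + k, so that the same
    cancellation rule applies to both.\<close>
  have "frac_expand s \<gamma> I e (X \<oplus>\<^bsub>loc I\<^esub> Y) a
      = fs_smult s (T I k' m) (inv_tpow \<gamma> I e (\<lambda>i. k i + k' i)) a
      + fs_smult s (T I k m') (inv_tpow \<gamma> I e (\<lambda>i. k' i + k i)) a"
    using X Y assms(1) by (simp add: frac_add frac_expand_frac fs_smult_add_left add.commute)
  then show ?thesis
    using X Y assms(1) by (simp only: fs_smult_T frac_expand_frac)
qed

text \<open>The added indices have exponent zero, so a Cech face keeps the formal sum of the
  fraction it comes from, including its independence of the new signs.\<close>

lemma frac_expand_loc_map:
  assumes "K \<subseteq> J" "J \<subseteq> B" "X \<in> carrier (loc K)"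
  shows "frac_expand s \<gamma> J e (loc_map group_ring P t J (\<lambda>m. m) X) = frac_expand s \<gamma> K e X"
proof -
  obtain m k where X: "k \<in> exponents K" "X = frac K m k"
    using assms(3) by (auto simp: loc_carrier)
  have "finite J" using assms finite_B finite_subset by blast
  moreover have "k \<in> exponents J" using X exponents_mono assms by blast
  ultimately show ?thesis
    using X assms by (simp add: loc_map_id_frac frac_expand_frac inv_tpow_subset)
qed

lemma frac_expand_sign_cong:
  assumes "I \<subseteq> B" "X \<in> carrier (loc I)" "\<And>i. i \<in> I \<Longrightarrow> e i = e' i"
  shows "frac_expand s \<gamma> I e X = frac_expand s \<gamma> I e' X"
  using assms
  by (auto simp: loc_carrier frac_expand_frac intro!: arg_cong[where f = "fs_smult s _"] inv_tpow_cong)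

end

section \<open>Residues of lifts of cocycles\<close>

context stabilizer_code
begin

lemma form_action: "form_action s w"
proof -
  interpret Module.module Zn "local_module s" by (rule local_module)
  have [simp]: "carrier (local_module s) = UNIV" "x \<oplus>\<^bsub>local_module s\<^esub> y = x + y"
    "r \<odot>\<^bsub>local_module s\<^esub> x = s r x" for x y r
    by (simp_all add: local_module_def mk_module_def)
  have [simp]: "carrier Zn = UNIV" "r \<oplus>\<^bsub>Zn\<^esub> r' = r + r'" "r \<otimes>\<^bsub>Zn\<^esub> r' = r * r'"
    "\<one>\<^bsub>Zn\<^esub> = of_int_mod_ring 1" for r r' :: "'c::finite mod_ring"
    by (simp_all add: Zn_def)
  show ?thesis
    using smult_l_distr smult_r_distr smult_assoc1 smult_one
    by unfold_locales (simp_all add: form_add_right form_scale_right)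
qed

end

locale code_expansion = stabilizer_code s w L + free_family \<gamma> "{..<D}"
  for s :: "'n::finite mod_ring \<Rightarrow> 'p \<Rightarrow> 'p::ab_group_add"
    and w :: "'p \<Rightarrow> 'p \<Rightarrow> 'n mod_ring"
    and L :: "('g::ab_group_add \<Rightarrow>\<^sub>0 'p) set"
    and \<gamma> :: "nat \<Rightarrow> 'g" and D :: nat
begin

sublocale form_action s w by (rule form_action)

sublocale expansion s \<gamma> "{..<D}" ..

abbreviation Q where "Q \<equiv> code_quotient s L"
abbreviation \<pi> where "\<pi> \<equiv> \<lambda>q. L +>\<^bsub>P\<^esub> q"

sublocale proj: localization_hom group_ring P Q t \<pi>
proof -
  note quot = module_pauli_module submodule
  have "Module.module group_ring Q"
    unfolding code_quotient_def by (rule module_quot_module[OF quot])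
  then show "localization_hom group_ring P Q t \<pi>"
    unfolding code_quotient_def
    using quot_map_add[OF quot] quot_map_smult[OF quot] quot_map_surj[of P L]
    by (intro localization_hom.intro localization_hom_axioms.intro localization.intro
        localization_axioms.intro module_pauli_module) auto
qed

lemma \<pi>_eq_zero_iff: "\<pi> q = \<zero>\<^bsub>Q\<^esub> \<longleftrightarrow> q \<in> L"
  unfolding code_quotient_def using quot_map_eq_zero_iff[OF module_pauli_module submodule, of q] by simp

lemma \<pi>_surj: "\<pi> ` carrier P = carrier Q"
  unfolding code_quotient_def by (rule quot_map_surj)

text \<open>Residue of a single fraction: unlike \<open>Res\<close>, which takes a whole cochain, it
  can be treated as an additive map on one localization.\<close>

definition res_frac where
  "res_frac I X a = (\<Sum>e\<in>I \<rightarrow>\<^sub>E {1, - 1}. zscale (\<Prod>i\<in>I. e i) (frac_expand s \<gamma> I e X a))"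

lemma Res_eq: "Res s \<gamma> \<phi> I = res_frac I (\<phi> I)"
  by (simp add: Res_def res_frac_def fun_eq_iff)

lemma cech_index_subset: "I \<in> cech_index D p \<Longrightarrow> I \<subseteq> {..<D}" "I \<in> cech_index D p \<Longrightarrow> finite I"
  using finite_subset by (auto simp: cech_index_def)

lemma res_frac_add:
  assumes "I \<subseteq> {..<D}" "X \<in> carrier (loc I)" "Y \<in> carrier (loc I)"
  shows "res_frac I (X \<oplus>\<^bsub>loc I\<^esub> Y) a = res_frac I X a + res_frac I Y a"
  using assms by (simp add: res_frac_def frac_expand_add zscale_add_right sum.distrib)

lemma cech_face:
  assumes "I \<in> cech_index D (Suc q)" "i \<in> I"
  shows "I - {i} \<in> cech_index D q"
  using assms cech_index_subset(2)[OF assms(1)] by (auto simp: cech_index_def)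

text \<open>Used with \<open>h\<close> the residue of a fraction, and with \<open>h\<close> the
  pairing of an element of L with one expansion.\<close>

lemma additive_cech_diff:
  fixes h :: "_ \<Rightarrow> 'b::ab_group_add"
  assumes I: "I \<in> cech_index D (Suc q)"
    and \<psi>: "\<And>K. K \<in> cech_index D q \<Longrightarrow> \<psi> K \<in> carrier (loc K)"
    and add: "\<And>X Y. X \<in> carrier (loc I) \<Longrightarrow> Y \<in> carrier (loc I) \<Longrightarrow> h (X \<oplus>\<^bsub>loc I\<^esub> Y) = h X + h Y"
  shows "h (cech_diff group_ring P t D q \<psi> I) = (\<Sum>i\<in>I. zscale ((- 1) ^ card {j \<in> I. j < i})
    (h (loc_map group_ring P t I (\<lambda>m. m) (\<psi> (I - {i})))))"
proof -
  interpret LI: abelian_group "loc I" by (rule abelian_group_loc)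
  have closed: "loc_map group_ring P t I (\<lambda>m. m) (\<psi> (I - {i})) \<in> carrier (loc I)" if "i \<in> I" for i
    using cech_face_closed[OF I that \<psi>] .
  have "h (cech_diff group_ring P t D q \<psi> I)
      = (\<Sum>i\<in>I. h (add_pow (loc I) ((- 1 :: int) ^ card {j \<in> I. j < i})
          (loc_map group_ring P t I (\<lambda>m. m) (\<psi> (I - {i})))))"
    using I closed
    by (simp add: cech_diff_def additive_finsum[OF abelian_group_loc add] Pi_iff)
  also have "\<dots> = (\<Sum>i\<in>I. zscale ((- 1) ^ card {j \<in> I. j < i})
      (h (loc_map group_ring P t I (\<lambda>m. m) (\<psi> (I - {i})))))"
    using closed by (intro sum.cong refl additive_add_pow[OF abelian_group_loc add]) auto
  finally show ?thesis .
qed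

text \<open>The face without \<open>i\<close> does not depend on the sign at \<open>i\<close>, so its signed sum vanishes.\<close>

lemma sum_signs_face:
  fixes H :: "('g \<Rightarrow> 'p) \<Rightarrow> 'b::ab_group_add"
  assumes "I \<subseteq> {..<D}" "i \<in> I" "J \<subseteq> {..<D}" "i \<notin> J" "X \<in> carrier (loc J)"
  shows "(\<Sum>e\<in>I \<rightarrow>\<^sub>E {1, - 1}. zscale (\<Prod>i\<in>I. e i) (H (frac_expand s \<gamma> J e X))) = 0"
proof (rule sum_signs_eq_zero)
  show "finite I" using assms(1) finite_subset by blast
  show "H (frac_expand s \<gamma> J (e(i := 1)) X) = H (frac_expand s \<gamma> J (e(i := - 1)) X)" for e
    using assms by (intro arg_cong[where f = H] frac_expand_sign_cong) auto
qed fact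

lemma res_frac_cech_diff:
  assumes I: "I \<in> cech_index D (Suc q)"
    and \<psi>: "\<And>K. K \<in> cech_index D q \<Longrightarrow> \<psi> K \<in> carrier (loc K)"
  shows "res_frac I (cech_diff group_ring P t D q \<psi> I) a = 0"
proof -
  have "res_frac I (loc_map group_ring P t I (\<lambda>m. m) (\<psi> (I - {i}))) a = 0" if i: "i \<in> I" for i
  proof -
    have "frac_expand s \<gamma> I e (loc_map group_ring P t I (\<lambda>m. m) (\<psi> (I - {i})))
        = frac_expand s \<gamma> (I - {i}) e (\<psi> (I - {i}))" for e
      using cech_index_subset[OF I] \<psi>[OF cech_face[OF I i]] by (intro frac_expand_loc_map) auto
    then show ?thesis
      using sum_signs_face[of I i "I - {i}" "\<psi> (I - {i})" "\<lambda>f. f a"]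
        cech_index_subset[OF I] \<psi>[OF cech_face[OF I i]] i
      by (auto simp: res_frac_def)
  qed
  then show ?thesis
    using additive_cech_diff[OF I \<psi>, of "\<lambda>X. res_frac I X a"] res_frac_add cech_index_subset[OF I]
    by simp
qed

text \<open>The signs concern only the denominator, so the residue is the numerator acting on one
  formal sum. A numerator in L thus yields a single term of the formal span.\<close>

lemma res_frac_frac:
  assumes "I \<subseteq> {..<D}" "k \<in> exponents I"
  shows "res_frac I (frac I m k)
    = fs_smult s m (\<lambda>a. \<Sum>e\<in>I \<rightarrow>\<^sub>E {1, - 1}. zscale (\<Prod>i\<in>I. e i) (inv_tpow \<gamma> I e k a))"
  using assms
  by (simp add: fun_eq_iff res_frac_def frac_expand_frac fs_smult_sum_right fs_smult_zscale_right)

lemma fs_smult_in_formal_span: "l \<in> L \<Longrightarrow> fs_smult s l f \<in> formal_span s L"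
  unfolding formal_span_def
  by (auto intro!: exI[of _ "1 :: nat"] exI[of _ "\<lambda>_. l"] exI[of _ "\<lambda>_. f"])

text \<open>Common core of the independence of the lift and of the cocycle: \<open>X\<close> and
  \<open>Y\<close> lift the same fraction over P/L, and their difference is a fraction with
  numerator in L.\<close>

lemma res_frac_diff_in_formal_span:
  assumes I: "I \<subseteq> {..<D}" and XY: "X \<in> carrier (loc I)" "Y \<in> carrier (loc I)"
    and eq: "loc_map group_ring Q t I \<pi> X = loc_map group_ring Q t I \<pi> Y"
  shows "(\<lambda>a. res_frac I X a - res_frac I Y a) \<in> formal_span s L"
proof -
  have fin: "finite I" using I finite_subset by blast
  obtain Z where Z: "Z \<in> carrier (loc I)" "loc_map group_ring Q t I \<pi> Z = \<zero>\<^bsub>proj.N.loc I\<^esub>"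
      "X = Y \<oplus>\<^bsub>loc I\<^esub> Z"
    using abelian_group_eq_addI[OF abelian_group_loc proj.N.abelian_group_loc
        proj.loc_map_hom[OF fin subset_refl] XY eq] .
  obtain m k where m: "k \<in> exponents I" "\<pi> m = \<zero>\<^bsub>Q\<^esub>" "Z = frac I m k"
    using proj.loc_map_eq_zeroE[OF fin Z(1,2)] .
  have "(\<lambda>a. res_frac I X a - res_frac I Y a) = res_frac I (frac I m k)"
    using I XY Z by (auto simp: res_frac_add m(3)[symmetric])
  then show ?thesis
    using m by (simp add: \<pi>_eq_zero_iff res_frac_frac[OF I] fs_smult_in_formal_span)
qed

lemma is_liftD:
  assumes "is_lift s L t D p \<phi>t \<phi>" "K \<in> cech_index D p"
  shows "\<phi>t K \<in> carrier (loc K)" "loc_map group_ring Q t K \<pi> (\<phi>t K) = \<phi> K"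
  using assms by (auto simp: is_lift_def cech_def)

text \<open>
  On the index set \<open>insert i I\<close> the coboundary of the lift lies in the localization of \<open>L\<close>, so it
  pairs to zero with \<open>l\<close>. After summation over the signs on \<open>I\<close> only the face \<open>I\<close> survives.
\<close>

lemma omega_hat_Res:
  assumes \<phi>: "\<phi> \<in> cech_cocycles group_ring Q t D p" and lift: "is_lift s L t D p \<phi>t \<phi>"
    and p: "p < D" and I: "I \<in> cech_index D p" and l: "l \<in> L"
  shows "omega_hat w l (Res s \<gamma> \<phi>t I) c = 0"
proof -
  have "\<not> {..<D} \<subseteq> I"
  proof
    assume "{..<D} \<subseteq> I"
    then have "card {..<D} \<le> card I" using cech_index_subset[OF I] by (intro card_mono) auto
    then show False using p I by (simp add: cech_index_def)
  qed
  then obtain i where i: "i < D" "i \<notin> I" by auto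
  define J where "J = insert i I"
  have J: "J \<in> cech_index D (Suc p)"
    using i I cech_index_subset[OF I] by (auto simp: J_def cech_index_def)
  note subs = cech_index_subset[OF I] cech_index_subset[OF J]
  have face: "\<phi>t (J - {j}) \<in> carrier (loc (J - {j}))" if "j \<in> J" for j
    using is_liftD[OF lift] cech_face[OF J that] by blast
  let ?d = "cech_diff group_ring P t D p \<phi>t J"
  have "?d \<in> carrier (loc J)" by (rule cech_diff_closed[OF J is_liftD(1)[OF lift]])
  moreover have "loc_map group_ring Q t J \<pi> ?d = \<zero>\<^bsub>proj.N.loc J\<^esub>"
    using proj.loc_map_cech_diff[OF J is_liftD[OF lift]] \<phi> J by (simp add: cech_cocycles_def)
  ultimately obtain m k where m: "k \<in> exponents J" "\<pi> m = \<zero>\<^bsub>Q\<^esub>" "?d = frac J m k"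
    using proj.loc_map_eq_zeroE[OF subs(4)] by metis
  define sg :: "nat \<Rightarrow> int" where "sg j = (- 1) ^ card {i \<in> J. i < j}" for j
  define h where "h j e = omega_hat w l (frac_expand s \<gamma> (J - {j}) e (\<phi>t (J - {j}))) c" for j e
  \<comment> \<open>Proved for every function \<open>e\<close>: in the sum over signs on
    \<open>I\<close> below, the entry of \<open>e\<close> at \<open>i\<close> is the default value
    \<open>undefined\<close>, which \<open>geom\<close> reads as one of the two signs.\<close>
  have sum_h: "(\<Sum>j\<in>J. zscale (sg j) (h j e)) = 0" for e
  proof -
    have "omega_hat w l (frac_expand s \<gamma> J e ?d) c
        = (\<Sum>j\<in>J. zscale (sg j) (omega_hat w l
            (frac_expand s \<gamma> J e (loc_map group_ring P t J (\<lambda>m. m) (\<phi>t (J - {j})))) c))"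
      unfolding sg_def
    proof (rule additive_cech_diff[OF J is_liftD(1)[OF lift]])
      fix X Y assume XY: "X \<in> carrier (loc J)" "Y \<in> carrier (loc J)"
      have "frac_expand s \<gamma> J e (X \<oplus>\<^bsub>loc J\<^esub> Y)
          = (\<lambda>a. frac_expand s \<gamma> J e X a + frac_expand s \<gamma> J e Y a)"
        using frac_expand_add[OF subs(3) XY] by blast
      then show "omega_hat w l (frac_expand s \<gamma> J e (X \<oplus>\<^bsub>loc J\<^esub> Y)) c
          = omega_hat w l (frac_expand s \<gamma> J e X) c + omega_hat w l (frac_expand s \<gamma> J e Y) c"
        by (simp add: omega_hat_add)
    qed
    also have "\<dots> = (\<Sum>j\<in>J. zscale (sg j) (h j e))"
      using face
      by (intro sum.cong refl) (simp add: h_def frac_expand_loc_map[OF Diff_subset subs(3) face])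
    \<comment> \<open>The numerator m lies in L, so isotropy already gives
      \<open>omega w l m = 0\<close>.\<close>
    also have "omega_hat w l (frac_expand s \<gamma> J e ?d) c = 0"
      using m l isotropic[of l m]
      by (simp add: \<pi>_eq_zero_iff frac_expand_frac[OF subs(3)] omega_hat_fs_smult)
    finally show ?thesis by simp
  qed
  \<comment> \<open>For j in \<open>I\<close> the face J - {j} omits j, whose sign is summed over.
    The sign at \<open>i\<close> is not summed over, so the face without \<open>i\<close> escapes
    this argument.\<close>
  have h_zero: "(\<Sum>e\<in>I \<rightarrow>\<^sub>E {1, - 1}. zscale (\<Prod>i\<in>I. e i) (h j e)) = 0" if "j \<in> I" for j
    unfolding h_def using subs face that
    by (intro sum_signs_face[where H = "\<lambda>f. omega_hat w l f c"]) (auto simp: J_def)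
  have "0 = (\<Sum>e\<in>I \<rightarrow>\<^sub>E {1, - 1}. zscale (\<Prod>i\<in>I. e i) (\<Sum>j\<in>J. zscale (sg j) (h j e)))"
    by (simp add: sum_h)
  also have "\<dots> = (\<Sum>j\<in>J. zscale (sg j) (\<Sum>e\<in>I \<rightarrow>\<^sub>E {1, - 1}. zscale (\<Prod>i\<in>I. e i) (h j e)))"
    by (simp add: zmod.scale_sum_right zscale_zscale mult.commute) (rule sum.swap)
  also have "\<dots> = zscale (sg i) (\<Sum>e\<in>I \<rightarrow>\<^sub>E {1, - 1}. zscale (\<Prod>i\<in>I. e i) (h i e))"
    using i subs h_zero by (simp add: J_def)
  also have "(\<Sum>e\<in>I \<rightarrow>\<^sub>E {1, - 1}. zscale (\<Prod>i\<in>I. e i) (h i e)) = omega_hat w l (Res s \<gamma> \<phi>t I) c"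
    using i by (simp add: h_def J_def Res_def omega_hat_sum omega_hat_zscale)
  finally have "zscale (sg i) (omega_hat w l (Res s \<gamma> \<phi>t I) c) = 0" by simp
  moreover have "sg i = 1 \<or> sg i = - 1"
    by (simp add: sg_def minus_one_power_iff)
  ultimately show ?thesis by (auto simp: zscale_uminus)
qed

lemma Res_lift_diff:
  assumes "is_lift s L t D p \<phi>t \<phi>" "is_lift s L t D p \<phi>t' \<phi>" "I \<in> cech_index D p"
  shows "(\<lambda>a. Res s \<gamma> \<phi>t' I a - Res s \<gamma> \<phi>t I a) \<in> formal_span s L"
  unfolding Res_eq using is_liftD[OF assms(1,3)] is_liftD[OF assms(2,3)] cech_index_subset[OF assms(3)]
  by (intro res_frac_diff_in_formal_span) auto

lemma Res_cech_diff:
  assumes "is_lift s L t D q \<psi>t \<psi>" "I \<in> cech_index D (Suc q)"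
  shows "Res s \<gamma> (cech_diff group_ring P t D q \<psi>t) I = (\<lambda>a. 0)"
  unfolding Res_eq using res_frac_cech_diff[OF assms(2) is_liftD(1)[OF assms(1)]] by blast

text \<open>Comparing cohomologous cocycles requires some lift of the cochain between them; the
  residues of its coboundary vanish whichever lift is chosen.\<close>

lemma lift_exists:
  assumes "\<psi> \<in> cech group_ring Q t D q"
  obtains \<psi>t where "is_lift s L t D q \<psi>t \<psi>"
proof -
  have "\<exists>X\<in>carrier (loc K). loc_map group_ring Q t K \<pi> X = \<psi> K" if "K \<in> cech_index D q" for K
    using assms cech_index_subset[OF that] that
    by (intro proj.loc_map_surj \<pi>_surj) (auto simp: cech_def)
  then obtain f where "\<forall>K\<in>cech_index D q. f K \<in> carrier (loc K) \<and> loc_map group_ring Q t K \<pi> (f K) = \<psi> K"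
    by metis
  then have "is_lift s L t D q (restrict f (cech_index D q)) \<psi>"
    by (auto simp: is_lift_def cech_def)
  then show ?thesis by (rule that)
qed

text \<open>Adding to \<open>\<phi>t I\<close> the coboundary of a lift of \<psi> gives a fraction
  with the same image over P/L as \<open>\<phi>t' I\<close>, and the added coboundary has residue
  zero.\<close>

lemma Res_cohomologous:
  assumes lift: "is_lift s L t D p \<phi>t \<phi>" "is_lift s L t D p \<phi>t' \<phi>'" and I: "I \<in> cech_index D p"
    and coh: "cohomologous group_ring Q t D p \<phi> \<phi>'"
  shows "(\<lambda>a. Res s \<gamma> \<phi>t' I a - Res s \<gamma> \<phi>t I a) \<in> formal_span s L"
proof (cases p)
  case 0
  then show ?thesis using Res_lift_diff lift I coh by simp
next
  case (Suc q)
  then obtain \<psi> where \<psi>: "\<psi> \<in> cech group_ring Q t D q"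
      "\<And>I. I \<in> cech_index D (Suc q) \<Longrightarrow>
        \<phi>' I = \<phi> I \<oplus>\<^bsub>proj.N.loc I\<^esub> cech_diff group_ring Q t D q \<psi> I"
    using coh by auto
  obtain \<psi>t where \<psi>t: "is_lift s L t D q \<psi>t \<psi>" using lift_exists[OF \<psi>(1)] .
  note I' = I[unfolded Suc]
  let ?d = "cech_diff group_ring P t D q \<psi>t I"
  note subs = cech_index_subset[OF I]
  have d: "?d \<in> carrier (loc I)" by (rule cech_diff_closed[OF I' is_liftD(1)[OF \<psi>t]])
  have closed: "\<phi>t I \<in> carrier (loc I)" "\<phi>t' I \<in> carrier (loc I)"
    using is_liftD(1) lift I by blast+
  interpret LI: abelian_group "loc I" by (rule abelian_group_loc)
  have "loc_map group_ring Q t I \<pi> (\<phi>t I \<oplus>\<^bsub>loc I\<^esub> ?d)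
      = loc_map group_ring Q t I \<pi> (\<phi>t I) \<oplus>\<^bsub>proj.N.loc I\<^esub> loc_map group_ring Q t I \<pi> ?d"
    using proj.loc_map_hom[OF subs(2) subset_refl] closed d by (simp add: hom_def)
  also have "\<dots> = loc_map group_ring Q t I \<pi> (\<phi>t' I)"
    using is_liftD(2)[OF lift(1) I] is_liftD(2)[OF lift(2) I] \<psi>(2)[OF I']
      proj.loc_map_cech_diff[OF I' is_liftD[OF \<psi>t]] by simp
  finally have "(\<lambda>a. res_frac I (\<phi>t' I) a - res_frac I (\<phi>t I \<oplus>\<^bsub>loc I\<^esub> ?d) a) \<in> formal_span s L"
    using closed d subs by (intro res_frac_diff_in_formal_span) auto
  then show ?thesis
    using closed d subs res_frac_cech_diff[OF I' is_liftD(1)[OF \<psi>t]] by (simp add: Res_eq res_frac_add)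
qed

text \<open>The support of the numerator is the required finite set of translates; the expanded
  denominators contribute only directions in the span of the \<gamma>_i with i in
  \<open>I\<close>.\<close>

lemma extended_along_Res:
  assumes lift: "is_lift s L t D p \<phi>t \<phi>" and I: "I \<in> cech_index D p"
  shows "extended_along (\<gamma> ` I) (Res s \<gamma> \<phi>t I)"
proof -
  note subs = cech_index_subset[OF I]
  obtain m k where m: "k \<in> exponents I" "\<phi>t I = frac I m k"
    using is_liftD(1)[OF lift I] by (auto simp: loc_carrier)
  define f :: "'g \<Rightarrow> 'n mod_ring"
    where "f a = (\<Sum>e\<in>I \<rightarrow>\<^sub>E {1, - 1}. zscale (\<Prod>i\<in>I. e i) (inv_tpow \<gamma> I e k a))" for a
  have Res: "Res s \<gamma> \<phi>t I = fs_smult s m f"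
    using m subs by (simp add: Res_eq res_frac_frac f_def[abs_def])
  have f: "f a = 0" if "a \<notin> zmod.span (\<gamma> ` I)" for a
    using that subs by (simp add: f_def inv_tpow_eq_zero)
  have "a \<in> {b + c |b c. b \<in> Poly_Mapping.keys m \<and> c \<in> zmod.span (\<gamma> ` I)}"
    if nz: "Res s \<gamma> \<phi>t I a \<noteq> 0" for a
  proof -
    obtain b where b: "b \<in> Poly_Mapping.keys m" "s (f (a - b)) (Poly_Mapping.lookup m b) \<noteq> 0"
      using nz unfolding Res fs_smult_def by (meson sum.not_neutral_contains_not_neutral)
    then have "a - b \<in> zmod.span (\<gamma> ` I)" using f by force
    moreover have "a = b + (a - b)" by simp
    ultimately show ?thesis using b by blast
  qed
  then show ?thesis
    unfolding extended_along_def by (intro exI[of _ "Poly_Mapping.keys m"]) auto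
qed

end

text \<open>Parts (a), (b) and (c) are the first three conjuncts; the last two make precise that the
  residues form a symmetry depending only on the cohomology class. The bound p < D leaves room for
  an index outside \<open>I\<close>, where the cocycle condition has content.\<close>

theorem mainTheorem5:
  fixes s :: "'n::finite mod_ring \<Rightarrow> 'p \<Rightarrow> 'p::ab_group_add"
    and w :: "'p \<Rightarrow> 'p \<Rightarrow> 'n mod_ring"
    and L :: "('g::ab_group_add \<Rightarrow>\<^sub>0 'p) set"
    and \<Gamma> :: "'g set"
    and \<gamma> :: "nat \<Rightarrow> 'g"
    and t :: "nat \<Rightarrow> 'g \<Rightarrow>\<^sub>0 'n mod_ring"
    and D p :: nat
  defines "t \<equiv> (\<lambda>j. xpow 0 - xpow (\<gamma> j))"
  assumes code: "lagrangian_code s w L"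
    and rank: "D = free_rank TYPE('g)"
    and charges_dim: "\<And>i. carrier (charge_module s L i) = {\<zero>\<^bsub>charge_module s L i\<^esub>} \<or>
          krull_dim group_ring (charge_module s L i) = 0"
    and finite_index: "finite_index \<Gamma>"
    and basis: "inj_on \<gamma> {..<D}" "\<not> zmod.dependent (\<gamma> ` {..<D})"
          "\<Gamma> = zmod.span (\<gamma> ` {..<D})"
    and annihilates: "\<And>g i. g \<in> \<Gamma> \<Longrightarrow>
          xpow g - xpow 0 \<in> annihilator group_ring (charge_module s L i)"
    and cocycle: "\<phi> \<in> cech_cocycles group_ring (code_quotient s L) t D p"
    and lift: "is_lift s L t D p \<phi>t \<phi>"
  shows
    "(p < D \<longrightarrow> (\<forall>I\<in>cech_index D p. \<forall>l\<in>L. omega_hat w l (Res s \<gamma> \<phi>t I) = (\<lambda>a. 0))) \<and>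
     (\<forall>\<phi>t'. is_lift s L t D p \<phi>t' \<phi> \<longrightarrow>
        (\<forall>I\<in>cech_index D p. (\<lambda>a. Res s \<gamma> \<phi>t' I a - Res s \<gamma> \<phi>t I a) \<in> formal_span s L)) \<and>
     (\<forall>q \<psi> \<psi>t. p = Suc q \<and> \<psi> \<in> cech group_ring (code_quotient s L) t D q \<and>
        \<phi> = cech_diff group_ring (code_quotient s L) t D q \<psi> \<and>
        is_lift s L t D q \<psi>t \<psi> \<and>
        \<phi>t = cech_diff group_ring (pauli_module s) t D q \<psi>t \<longrightarrow>
        (\<forall>I\<in>cech_index D p. Res s \<gamma> \<phi>t I = (\<lambda>a. 0))) \<and>
     (p < D \<longrightarrow> form_symmetry w L \<gamma> D p (Res s \<gamma> \<phi>t)) \<and>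
     (\<forall>\<phi>' \<phi>t'. \<phi>' \<in> cech_cocycles group_ring (code_quotient s L) t D p \<and>
        cohomologous group_ring (code_quotient s L) t D p \<phi> \<phi>' \<and>
        is_lift s L t D p \<phi>t' \<phi>' \<longrightarrow>
        (\<forall>I\<in>cech_index D p. (\<lambda>a. Res s \<gamma> \<phi>t' I a - Res s \<gamma> \<phi>t I a) \<in> formal_span s L))"
proof -
  interpret lagrangian_code s w L by (rule code)
  interpret E: code_expansion s w L \<gamma> D
    by unfold_locales (use basis in auto)
  have t: "t = E.t"
    by (simp add: t_def E.t_def fun_eq_iff)
  note cocycle = cocycle[unfolded t] and lift = lift[unfolded t]
  have a: "omega_hat w l (Res s \<gamma> \<phi>t I) = (\<lambda>a. 0)" if "p < D" "I \<in> cech_index D p" "l \<in> L" for I l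
    using E.omega_hat_Res[OF cocycle lift that] by blast
  show ?thesis
    unfolding t
    using a E.Res_lift_diff[OF lift] E.Res_cech_diff E.Res_cohomologous[OF lift]
      E.extended_along_Res[OF lift]
    by (auto simp: form_symmetry_def preserves_state_def)
qed

end
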